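(* Let $\Xi_G = \bigl\{ x=\sum_{k=1}^\infty x_k 2^{-k} : x_k\in\{0,1\},\ x_k x_{2k}=0 \text{ for all } k\ge 1\bigr\}\subset[0,1]$ and let $s=\dim_H(\Xi_G)$ be its Hausdorff dimension. **(i)** The set $\Xi_G$ has infinite, and in fact not $\sigma$-finite, $s$-dimensional Hausdorff measure. Moreover, for all sufficiently small $c>0$, the gauge function $$\phi(t)=t^s\exp\Bigl[-c\,\frac{|\log t|}{(\log|\log t|)^2}\Bigr]$$ satisfies $\mathcal{H}^{\phi}(\Xi_G)=\infty$, and furthermore $\Xi_G$ is not $\sigma$-finite with respect to $\mathcal{H}^{\phi}$. **(ii)** On the other hand, for every $\theta<2$, the gauge function $$\psi_\theta(t)=t^s\exp\Bigl[-\frac{|\log t|}{(\log|\log t|)^\theta}\Bigr]$$ satisfies $\mathcal{H}^{\psi_\theta}(\Xi_G)=0$.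
   Context: For a gauge function $\phi$ (continuous, increasing, $\phi(0)=0$), $\mathcal{H}^{\phi}$ denotes the generalized Hausdorff measure $\mathcal{H}^\phi(E)=\lim_{\varepsilon\to0}\inf\{\sum_j \phi(\mathrm{diam}\,U_j): E\subset\bigcup_j U_j,\ \mathrm{diam}\,U_j\le\varepsilon\}$ (countable covers). The gauges are given by their formulas for small $t>0$; only the behaviour near $t=0$ matters. A set is $\sigma$-finite with respect to $\mathcal{H}^\phi$ if it is a countable union of sets of finite $\mathcal{H}^\phi$-measure. *)

theory Defs
  imports "HOL-Analysis.Analysis"
begin

text \<open>The boundedness requirement makes \<^term>\<open>diameter\<close> the true diameter (it is unspecified for
  unbounded sets). For gauges with \<^term>\<open>\<phi> 0 = 0\<close>, padding with empty sets shows that finite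
  covers are included.\<close>

definition hausdorff_content :: "(real \<Rightarrow> real) \<Rightarrow> real \<Rightarrow> 'a::metric_space set \<Rightarrow> ennreal" where
  "hausdorff_content \<phi> \<epsilon> E =
     (INF U \<in> {U :: nat \<Rightarrow> 'a set. E \<subseteq> (\<Union>j. U j) \<and> (\<forall>j. bounded (U j) \<and> diameter (U j) \<le> \<epsilon>)}.
        \<Sum>j. ennreal (\<phi> (diameter (U j))))"

definition hausdorff_measure :: "(real \<Rightarrow> real) \<Rightarrow> 'a::metric_space set \<Rightarrow> ennreal" where
  "hausdorff_measure \<phi> E = Lim (at_right 0) (\<lambda>\<epsilon>. hausdorff_content \<phi> \<epsilon> E)"

definition hausdorff_sigma_finite :: "(real \<Rightarrow> real) \<Rightarrow> 'a::metric_space set \<Rightarrow> bool" where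
  "hausdorff_sigma_finite \<phi> E \<longleftrightarrow>
     (\<exists>A :: nat \<Rightarrow> 'a set. E = (\<Union>i. A i) \<and> (\<forall>i. hausdorff_measure \<phi> (A i) < \<infinity>))"

definition hausdorff_dim :: "'a::metric_space set \<Rightarrow> ennreal" where
  "hausdorff_dim E = (INF r \<in> {r. 0 < r \<and> hausdorff_measure (\<lambda>t. t powr r) E = 0}. ennreal r)"

text \<open>The digit \<^term>\<open>b 0\<close> plays no role.\<close>

definition Xi_G :: "real set" where
  "Xi_G = {x. \<exists>b :: nat \<Rightarrow> nat.
     (\<forall>k\<ge>1. b k \<in> {0, 1}) \<and> (\<forall>k\<ge>1. b k * b (2 * k) = 0) \<and>
     x = (\<Sum>k. real (b (Suc k)) / 2 ^ Suc k)}"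

text \<open>The limit defining \<^const>\<open>hausdorff_measure\<close> always exists and is a supremum.\<close>

lemma hausdorff_content_antimono:
  assumes "\<epsilon> \<le> \<delta>"
  shows "hausdorff_content \<phi> \<delta> E \<le> hausdorff_content \<phi> \<epsilon> E"
  unfolding hausdorff_content_def
  by (rule INF_superset_mono) (auto intro: order_trans[OF _ assms])

lemma tendsto_hausdorff_content:
  "((\<lambda>\<epsilon>. hausdorff_content \<phi> \<epsilon> E) \<longlongrightarrow> (SUP \<epsilon>\<in>{0<..}. hausdorff_content \<phi> \<epsilon> E)) (at_right 0)"
proof (rule order_tendstoI)
  fix a assume "a < (SUP \<epsilon>\<in>{0<..}. hausdorff_content \<phi> \<epsilon> E)"
  then obtain \<delta> where \<delta>: "0 < \<delta>" "a < hausdorff_content \<phi> \<delta> E"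
    unfolding less_SUP_iff by auto
  have "\<forall>\<^sub>F \<epsilon> in at_right 0. \<epsilon> < \<delta>"
    using \<delta>(1) unfolding eventually_at_right_field by blast
  then show "\<forall>\<^sub>F \<epsilon> in at_right 0. a < hausdorff_content \<phi> \<epsilon> E"
    by eventually_elim (rule less_le_trans[OF \<delta>(2) hausdorff_content_antimono], simp)
next
  fix a assume a: "(SUP \<epsilon>\<in>{0<..}. hausdorff_content \<phi> \<epsilon> E) < a"
  show "\<forall>\<^sub>F \<epsilon> in at_right 0. hausdorff_content \<phi> \<epsilon> E < a"
    using eventually_at_right_less[of "0::real"]
    by eventually_elim (rule le_less_trans[OF SUP_upper a], simp)
qed

lemma hausdorff_measure_eq_SUP:
  "hausdorff_measure \<phi> E = (SUP \<epsilon>\<in>{0<..}. hausdorff_content \<phi> \<epsilon> E)"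
  unfolding hausdorff_measure_def
  by (rule tendsto_Lim[OF _ tendsto_hausdorff_content]) simp

text \<open>Only the behaviour of the gauge near 0 matters, so a gauge may be replaced by any formula
  that agrees with it for small arguments.\<close>

lemma hausdorff_measure_cong:
  fixes E :: "'a::metric_space set"
  assumes "\<phi> 0 = \<psi> 0" and "\<forall>\<^sub>F t in at_right 0. \<phi> t = \<psi> t"
  shows "hausdorff_measure \<phi> E = hausdorff_measure \<psi> E"
proof -
  obtain d where d: "0 < d" "\<And>t. 0 < t \<Longrightarrow> t < d \<Longrightarrow> \<phi> t = \<psi> t"
    using assms(2) unfolding eventually_at_right_field by auto
  have eq: "hausdorff_content \<phi> \<epsilon> E = hausdorff_content \<psi> \<epsilon> E" if "\<epsilon> < d" for \<epsilon>
    unfolding hausdorff_content_def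
  proof (rule INF_cong[OF refl])
    fix U :: "nat \<Rightarrow> 'a set"
    assume U: "U \<in> {U. E \<subseteq> (\<Union>j. U j) \<and> (\<forall>j. bounded (U j) \<and> diameter (U j) \<le> \<epsilon>)}"
    have "\<phi> (diameter (U j)) = \<psi> (diameter (U j))" for j
    proof (cases "diameter (U j) = 0")
      case False
      have "0 \<le> diameter (U j)" "diameter (U j) \<le> \<epsilon>"
        using U by (auto intro: diameter_ge_0)
      then show ?thesis using False that by (intro d(2)) auto
    qed (simp add: assms(1))
    then show "(\<Sum>j. ennreal (\<phi> (diameter (U j)))) = (\<Sum>j. ennreal (\<psi> (diameter (U j))))"
      by simp
  qed
  have "\<forall>\<^sub>F \<epsilon> in at_right 0. hausdorff_content \<phi> \<epsilon> E = hausdorff_content \<psi> \<epsilon> E"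
    unfolding eventually_at_right_field using d(1) eq by blast
  then have "((\<lambda>\<epsilon>. hausdorff_content \<psi> \<epsilon> E) \<longlongrightarrow> hausdorff_measure \<phi> E) (at_right 0)"
    using tendsto_hausdorff_content[of \<phi> E] hausdorff_measure_eq_SUP[of \<phi> E]
    by (simp add: tendsto_cong)
  then show ?thesis
    unfolding hausdorff_measure_def[of \<psi>] by (intro tendsto_Lim[symmetric]) simp_all
qed

end

theory Submission
  imports Defs "HOL-Probability.Probability" "HOL-Real_Asymp.Real_Asymp"
begin

text \<open>
  Write \<open>x\<close> through the set \<open>A\<close> of positions of its ones. The condition \<open>x\<^sub>k x\<^sub>2\<^sub>k = 0\<close> links only the
  positions \<open>i, 2i, 4i, \<dots>\<close> for odd \<open>i\<close>, so a natural measure makes these chains independent Markov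
  chains: a one is followed by a zero, and a zero by a one with probability \<open>q = 1 - p\<close>. Let
  \<open>N n\<close> be the number of ones among the first \<open>n\<close> digits. For the root \<open>p\<close> of \<open>p\<^sup>3 = q\<^sup>2\<close>
  a prefix of length \<open>n\<close> has mass \<open>p\<close> raised to \<open>n + N n / 2 - N (n div 2)\<close> (\<open>weight_q\<close>). The
  correction is, along \<open>n = 2\<^sup>J\<close> and relative to \<open>n\<close>, half the increment of the density of ones.
  Densities are bounded, so the increments cannot stay above a positive constant, and the dimension is
  \<open>s = - log\<^sub>2 p\<close>. The gauges in question measure how small these increments can be made.

  Upper bound. Let \<open>d J\<close> be the amount by which the density of ones up to \<open>2\<^sup>J\<close> falls short of its
  typical value. Replacing \<open>q\<close> by \<open>q - \<epsilon>\<close> changes the logarithm of the mass, per digit, by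
  \<open>\<epsilon>\<close> times a positive combination of \<open>d J\<close> and \<open>d (J - 1)\<close>, up to \<open>O(\<epsilon>\<^sup>2)\<close>
  (\<open>weight_perturbed\<close>). With \<open>\<epsilon> = \<plusminus> \<kappa> / J\<close> the quadratic error \<open>O(1 / J\<^sup>2)\<close> is smaller than the
  correction \<open>J powr - \<theta>\<close> allowed by the gauge, because \<open>\<theta> < 2\<close>. If for some \<open>x\<close> both perturbed weights
  were too small at all large \<open>J\<close>, then \<open>d\<close> would satisfy two recursive inequalities: the one for \<open>+ \<kappa>\<close>
  drives \<open>d\<close> below zero through the divergence of the harmonic series, and the one for \<open>- \<kappa>\<close> then
  drives it to minus infinity (\<open>drifting_recursion_contradiction\<close>). Hence every point has heavy
  prefixes at arbitrarily large scales (\<open>heavy_prefix_exists\<close>). As the weights of all words of a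
  given length sum to at most one, the cylinders of these prefixes cover \<open>Xi_G\<close> at
  arbitrarily small cost (\<open>hausdorff_measure_Xi_G_null\<close>).

  Lower bound. The same computation shows how to beat \<open>t\<^sup>s\<close>: let the density of ones increase
  slowly, falling short of its typical value at position \<open>k\<close> by the fraction \<open>\<delta> / ln (4 k)\<close>. The telescoping
  term then gains a multiple of \<open>\<delta> n / (ln n)\<^sup>2\<close> (\<open>mean_drop_eventually\<close>), while the change of
  transition probabilities costs only the relative entropy, of order \<open>\<delta>\<^sup>2 n / (ln n)\<^sup>2\<close>
  (\<open>likelihood_ratio_mean\<close>), so small \<open>\<delta>\<close> wins. Exponential moment bounds show that, outside a set
  of words of summable total mass, every prefix of length \<open>n\<close> has mass at most \<open>p ^ n exp (- c n / (ln (4 n))\<^sup>2)\<close>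
  (\<open>overweight_mass_summable\<close>), and the mass distribution principle gives positive measure
  for the gauge with some constant \<open>c > 0\<close> (\<open>corrected_gauge_positive_measure\<close>). For
  \<open>c' < c\<close> that gauge is negligible against the one with constant \<open>c'\<close>, and so
  \<open>\<sigma>\<close>-finiteness for \<open>c'\<close> would force measure zero for \<open>c\<close>
  (\<open>hausdorff_null_if_sigma_finite\<close>). The case \<open>c' = 0\<close> is the power gauge.

  Words of length \<open>n\<close> are represented by subsets of \<open>{1..n}\<close>, and all estimates of masses are
  finite sums over such subsets. Only the mass distribution principle uses a measure on infinite sequences.
\<close>

section \<open>Covers and Hausdorff measures\<close>

lemma hausdorff_content_le_cover:
  assumes "E \<subseteq> (\<Union>j. U j)" "\<And>j. bounded (U j)" "\<And>j. diameter (U j) \<le> \<epsilon>"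
  shows "hausdorff_content \<phi> \<epsilon> E \<le> (\<Sum>j::nat. ennreal (\<phi> (diameter (U j))))"
  unfolding hausdorff_content_def using assms by (intro INF_lower) auto

lemma hausdorff_content_mono:
  assumes "A \<subseteq> B"
  shows "hausdorff_content \<phi> \<epsilon> A \<le> hausdorff_content \<phi> \<epsilon> B"
  unfolding hausdorff_content_def using assms by (intro INF_superset_mono) auto

lemma hausdorff_content_le_single:
  assumes "\<phi> 0 = 0" "E \<subseteq> U" "bounded U" "diameter U \<le> \<epsilon>"
  shows "hausdorff_content \<phi> \<epsilon> E \<le> ennreal (\<phi> (diameter U))"
proof -
  \<comment> \<open>Empty sets pad the cover at no cost because the gauge vanishes at \<open>0\<close>.\<close>
  define V where "V = (\<lambda>j::nat. if j = 0 then U else {})"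
  have "0 \<le> \<epsilon>" using diameter_ge_0[OF assms(3)] assms(4) by simp
  then have "hausdorff_content \<phi> \<epsilon> E \<le> (\<Sum>j. ennreal (\<phi> (diameter (V j))))"
    using assms by (intro hausdorff_content_le_cover) (auto simp: V_def)
  also have "\<dots> = (\<Sum>j\<in>{0}. ennreal (\<phi> (diameter (V j))))"
    by (rule suminf_finite) (auto simp: V_def assms(1))
  finally show ?thesis by (simp add: V_def)
qed

text \<open>Covers that are optimal up to \<open>e / 2\<^sup>i\<^sup>+\<^sup>1\<close> for the \<open>i\<close>-th set are merged by the pairing bijection.\<close>

lemma hausdorff_content_UN:
  "hausdorff_content \<phi> \<epsilon> (\<Union>i::nat. A i) \<le> (\<Sum>i. hausdorff_content \<phi> \<epsilon> (A i))"
proof (rule ennreal_le_epsilon)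
  fix e :: real
  assume fin: "(\<Sum>i. hausdorff_content \<phi> \<epsilon> (A i)) < top" and e: "0 < e"
  have "\<exists>U. A i \<subseteq> (\<Union>j::nat. U j) \<and> (\<forall>j. bounded (U j) \<and> diameter (U j) \<le> \<epsilon>) \<and>
      (\<Sum>j. ennreal (\<phi> (diameter (U j)))) \<le> hausdorff_content \<phi> \<epsilon> (A i) + ennreal (e * (1/2)^Suc i)" for i
  proof -
    have "hausdorff_content \<phi> \<epsilon> (A i) < top"
      using fin ennreal_suminf_lessD by blast
    then have "hausdorff_content \<phi> \<epsilon> (A i) < hausdorff_content \<phi> \<epsilon> (A i) + ennreal (e * (1/2)^Suc i)"
      using e by (cases "hausdorff_content \<phi> \<epsilon> (A i)")
        (auto simp: ennreal_less_iff simp del: ennreal_plus simp add: ennreal_plus[symmetric])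
    then show ?thesis
      unfolding hausdorff_content_def INF_less_iff by (auto intro: less_imp_le)
  qed
  then obtain U where U: "\<And>i. A i \<subseteq> (\<Union>j::nat. U i j)"
      "\<And>i j. bounded (U i j)" "\<And>i j. diameter (U i j) \<le> \<epsilon>"
      "\<And>i. (\<Sum>j. ennreal (\<phi> (diameter (U i j)))) \<le> hausdorff_content \<phi> \<epsilon> (A i) + ennreal (e * (1/2)^Suc i)"
    by metis
  define V where "V = (\<lambda>n. case prod_decode n of (i, j) \<Rightarrow> U i j)"
  have "hausdorff_content \<phi> \<epsilon> (\<Union>i. A i) \<le> (\<Sum>n. ennreal (\<phi> (diameter (V n))))"
  proof (rule hausdorff_content_le_cover)
    show "(\<Union>i. A i) \<subseteq> (\<Union>n. V n)"
    proof
      fix x assume "x \<in> (\<Union>i. A i)"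
      then obtain i j where "x \<in> U i j" using U(1) by blast
      then have "x \<in> V (prod_encode (i, j))" by (simp add: V_def)
      then show "x \<in> (\<Union>n. V n)" by blast
    qed
  qed (auto simp: V_def U split: prod.split)
  also have "\<dots> = (\<Sum>i. \<Sum>j. ennreal (\<phi> (diameter (U i j))))"
    using suminf_ennreal_2dimen[of "\<lambda>i. \<Sum>j. ennreal (\<phi> (diameter (U i j)))"
        "\<lambda>(i, j). ennreal (\<phi> (diameter (U i j)))"]
    by (simp add: V_def case_prod_beta)
  also have "\<dots> \<le> (\<Sum>i. hausdorff_content \<phi> \<epsilon> (A i) + ennreal (e * (1/2)^Suc i))"
    by (intro suminf_le U(4) summableI)
  also have "\<dots> = (\<Sum>i. hausdorff_content \<phi> \<epsilon> (A i)) + (\<Sum>i. ennreal (e * (1/2)^Suc i))"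
    by (rule suminf_add[symmetric]) (auto intro: summableI)
  also have "(\<Sum>i. ennreal (e * (1/2)^Suc i)) = ennreal e"
  proof (rule suminf_ennreal_eq)
    show "(\<lambda>i. e * (1/2)^Suc i) sums e"
      using sums_mult[OF power_half_series, of e] by simp
  qed (use e in auto)
  finally show "hausdorff_content \<phi> \<epsilon> (\<Union>i. A i) \<le> (\<Sum>i. hausdorff_content \<phi> \<epsilon> (A i)) + ennreal e" .
qed

lemma hausdorff_content_finite_UN:
  assumes "\<phi> 0 = 0" "0 \<le> \<epsilon>" "finite I"
  shows "hausdorff_content \<phi> \<epsilon> (\<Union>i\<in>I. A i) \<le> (\<Sum>i\<in>I. hausdorff_content \<phi> \<epsilon> (A i))"
proof -
  obtain f where f: "bij_betw f {0..<card I} I"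
    using ex_bij_betw_nat_finite[OF assms(3)] by auto
  define B where "B = (\<lambda>j. if j < card I then A (f j) else {})"
  have 0: "hausdorff_content \<phi> \<epsilon> {} = 0"
    using hausdorff_content_le_single[of \<phi> "{}" "{}" \<epsilon>] assms(1,2) by simp
  have "(\<Union>i\<in>I. A i) = (\<Union>i\<in>f ` {0..<card I}. A i)" using f by (simp add: bij_betw_def)
  also have "\<dots> = (\<Union>j. B j)" by (auto simp: B_def)
  finally have "hausdorff_content \<phi> \<epsilon> (\<Union>i\<in>I. A i) \<le> (\<Sum>j. hausdorff_content \<phi> \<epsilon> (B j))"
    by (simp add: hausdorff_content_UN)
  also have "\<dots> = (\<Sum>j\<in>{0..<card I}. hausdorff_content \<phi> \<epsilon> (B j))"
    by (rule suminf_finite) (auto simp: B_def 0)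
  also have "\<dots> = (\<Sum>j\<in>{0..<card I}. hausdorff_content \<phi> \<epsilon> (A (f j)))"
    by (rule sum.cong) (auto simp: B_def)
  also have "\<dots> = (\<Sum>i\<in>I. hausdorff_content \<phi> \<epsilon> (A i))"
    by (rule sum.reindex_bij_betw[OF f])
  finally show ?thesis .
qed

lemma hausdorff_content_le_measure:
  "0 < \<epsilon> \<Longrightarrow> hausdorff_content \<phi> \<epsilon> E \<le> hausdorff_measure \<phi> E"
  unfolding hausdorff_measure_eq_SUP by (rule SUP_upper) simp

lemma hausdorff_measure_leI:
  assumes "0 < \<delta>" "\<And>\<epsilon>. 0 < \<epsilon> \<Longrightarrow> \<epsilon> < \<delta> \<Longrightarrow> hausdorff_content \<phi> \<epsilon> E \<le> M"
  shows "hausdorff_measure \<phi> E \<le> M"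
  unfolding hausdorff_measure_eq_SUP
proof (rule SUP_least)
  fix \<epsilon> :: real assume "\<epsilon> \<in> {0<..}"
  then have "hausdorff_content \<phi> (min \<epsilon> (\<delta>/2)) E \<le> M" using assms(1) by (intro assms(2)) auto
  moreover have "hausdorff_content \<phi> \<epsilon> E \<le> hausdorff_content \<phi> (min \<epsilon> (\<delta>/2)) E"
    by (rule hausdorff_content_antimono) simp
  ultimately show "hausdorff_content \<phi> \<epsilon> E \<le> M" by simp
qed

lemma hausdorff_measure_le_scaled:
  fixes E :: "'a::metric_space set"
  assumes "\<phi> 0 \<le> \<eta> * \<psi> 0" "\<forall>\<^sub>F t in at_right 0. \<phi> t \<le> \<eta> * \<psi> t" "0 < \<eta>"
  shows "hausdorff_measure \<phi> E \<le> ennreal \<eta> * hausdorff_measure \<psi> E"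
proof -
  obtain d where d: "0 < d" "\<And>t. 0 < t \<Longrightarrow> t < d \<Longrightarrow> \<phi> t \<le> \<eta> * \<psi> t"
    using assms(2) unfolding eventually_at_right_field by auto
  show ?thesis
  proof (rule hausdorff_measure_leI[OF d(1)])
    fix \<epsilon> :: real assume \<epsilon>: "0 < \<epsilon>" "\<epsilon> < d"
    have "ennreal (1/\<eta>) * hausdorff_content \<phi> \<epsilon> E \<le> (\<Sum>j. ennreal (\<psi> (diameter (U j))))"
      if U: "E \<subseteq> (\<Union>j. U j)" "\<And>j. bounded (U j)" "\<And>j. diameter (U j) \<le> \<epsilon>" for U :: "nat \<Rightarrow> 'a set"
    proof -
      have "\<phi> (diameter (U j)) \<le> \<eta> * \<psi> (diameter (U j))" for j
      proof (cases "diameter (U j) = 0")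
        case False
        moreover have "0 \<le> diameter (U j)" by (rule diameter_ge_0[OF U(2)])
        moreover have "diameter (U j) < d" using U(3)[of j] \<epsilon> by simp
        ultimately show ?thesis by (intro d(2)) auto
      qed (simp add: assms(1))
      then have "ennreal (\<phi> (diameter (U j))) \<le> ennreal \<eta> * ennreal (\<psi> (diameter (U j)))" for j
        using assms(3) by (metis ennreal_leI ennreal_mult' less_imp_le)
      then have "(\<Sum>j. ennreal (\<phi> (diameter (U j)))) \<le> (\<Sum>j. ennreal \<eta> * ennreal (\<psi> (diameter (U j))))"
        by (intro suminf_le summableI)
      then have "hausdorff_content \<phi> \<epsilon> E \<le> ennreal \<eta> * (\<Sum>j. ennreal (\<psi> (diameter (U j))))"
        using hausdorff_content_le_cover[OF U, of \<phi>] by simp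
      then have "ennreal (1/\<eta>) * hausdorff_content \<phi> \<epsilon> E
          \<le> ennreal (1/\<eta>) * (ennreal \<eta> * (\<Sum>j. ennreal (\<psi> (diameter (U j)))))"
        by (intro mult_left_mono) auto
      then show ?thesis
        using assms(3) by (simp add: mult.assoc[symmetric] ennreal_mult'[symmetric])
    qed
    then have "ennreal (1/\<eta>) * hausdorff_content \<phi> \<epsilon> E \<le> hausdorff_content \<psi> \<epsilon> E"
      unfolding hausdorff_content_def[of \<psi>] by (intro INF_greatest) auto
    then have "ennreal \<eta> * (ennreal (1/\<eta>) * hausdorff_content \<phi> \<epsilon> E) \<le> ennreal \<eta> * hausdorff_content \<psi> \<epsilon> E"
      by (intro mult_left_mono) auto
    then have "hausdorff_content \<phi> \<epsilon> E \<le> ennreal \<eta> * hausdorff_content \<psi> \<epsilon> E"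
      using assms(3) by (simp add: mult.assoc[symmetric] ennreal_mult'[symmetric])
    also have "\<dots> \<le> ennreal \<eta> * hausdorff_measure \<psi> E"
      by (intro mult_left_mono hausdorff_content_le_measure \<epsilon>) simp
    finally show "hausdorff_content \<phi> \<epsilon> E \<le> ennreal \<eta> * hausdorff_measure \<psi> E" .
  qed
qed

text \<open>If \<open>\<phi>\<close> is negligible against \<open>\<psi>\<close> near \<open>0\<close>, every set of finite \<open>\<psi>\<close>-measure has
  \<open>\<phi>\<close>-measure zero, and null sets are closed under countable unions.\<close>

lemma hausdorff_null_if_sigma_finite:
  fixes E :: "'a::metric_space set"
  assumes "hausdorff_sigma_finite \<psi> E" "\<phi> 0 = 0" "\<psi> 0 = 0"
    and small: "\<And>\<eta>. 0 < \<eta> \<Longrightarrow> \<forall>\<^sub>F t in at_right 0. \<phi> t \<le> \<eta> * \<psi> t"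
  shows "hausdorff_measure \<phi> E = 0"
proof -
  obtain A where A: "E = (\<Union>i::nat. A i)" "\<And>i. hausdorff_measure \<psi> (A i) < \<infinity>"
    using assms(1) unfolding hausdorff_sigma_finite_def by blast
  have null: "hausdorff_measure \<phi> (A i) = 0" for i
  proof -
    obtain M where M: "0 \<le> M" "hausdorff_measure \<psi> (A i) = ennreal M"
      using A(2)[of i] by (cases "hausdorff_measure \<psi> (A i)") auto
    have "hausdorff_measure \<phi> (A i) \<le> 0 + ennreal e" if "0 < e" for e
    proof -
      have pos: "0 < e / (M + 1)" using that M(1) by simp
      have "hausdorff_measure \<phi> (A i) \<le> ennreal (e / (M + 1)) * ennreal M"
        using hausdorff_measure_le_scaled[OF _ small[OF pos] pos, of "A i"] assms(2,3) M(2) by simp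
      also have "\<dots> = ennreal (e * (M / (M + 1)))"
        using that M(1) by (simp add: ennreal_mult[symmetric])
      also have "\<dots> \<le> ennreal e"
        using that M(1) by (intro ennreal_leI mult_left_le) auto
      finally show ?thesis by simp
    qed
    then have "hausdorff_measure \<phi> (A i) \<le> 0" by (rule ennreal_le_epsilon)
    then show ?thesis by simp
  qed
  have "hausdorff_measure \<phi> E \<le> 0"
  proof (rule hausdorff_measure_leI[OF zero_less_one])
    fix \<epsilon> :: real assume "0 < \<epsilon>"
    then have "hausdorff_content \<phi> \<epsilon> (A i) = 0" for i
      using hausdorff_content_le_measure[of \<epsilon> \<phi> "A i"] null[of i] by simp
    then show "hausdorff_content \<phi> \<epsilon> E \<le> 0"
      unfolding A(1) using hausdorff_content_UN[of \<phi> \<epsilon> A] by simp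
  qed
  then show ?thesis by simp
qed

lemma infinite_measure_if_not_sigma_finite:
  assumes "\<not> hausdorff_sigma_finite \<phi> E"
  shows "hausdorff_measure \<phi> E = \<infinity>"
proof (rule ccontr)
  assume "hausdorff_measure \<phi> E \<noteq> \<infinity>"
  then have "hausdorff_measure \<phi> E < \<infinity>" by (simp add: top.not_eq_extremum)
  then have "hausdorff_sigma_finite \<phi> E"
    unfolding hausdorff_sigma_finite_def by (intro exI[of _ "\<lambda>_. E"]) simp
  then show False using assms by contradiction
qed

section \<open>Admissible words and Markov weights\<close>

text \<open>A digit is free if its parent in the chain \<open>i, 2i, 4i, \<dots>\<close> is not a one. The digit at an odd
  position has no parent and is always free.\<close>

definition free :: "nat set \<Rightarrow> nat \<Rightarrow> bool" where
  "free A k \<longleftrightarrow> \<not> (even k \<and> k div 2 \<in> A)"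

definition admissible :: "nat set \<Rightarrow> bool" where
  "admissible A \<longleftrightarrow> (\<forall>k\<ge>1. k \<in> A \<longrightarrow> 2 * k \<notin> A)"

definition ones :: "nat set \<Rightarrow> nat \<Rightarrow> real" where
  "ones A n = (\<Sum>k=1..n. of_bool (k \<in> A))"

definition parent :: "(nat \<Rightarrow> real) \<Rightarrow> nat \<Rightarrow> real" where
  "parent f k = (if even k then f (k div 2) else 0)"

definition trans_prob :: "(nat \<Rightarrow> real) \<Rightarrow> nat set \<Rightarrow> nat \<Rightarrow> real" where
  "trans_prob r A k =
     (if free A k then (if k \<in> A then r k else 1 - r k) else (if k \<in> A then 0 else 1))"

text \<open>This is the mass of the first \<open>n\<close> digits of \<open>A\<close> under the Markov measure in which a free digit
  \<open>k\<close> is a one with probability \<open>r k\<close>. Inadmissible words have weight zero.\<close>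

definition weight :: "(nat \<Rightarrow> real) \<Rightarrow> nat \<Rightarrow> nat set \<Rightarrow> real" where
  "weight r n A = (\<Prod>k=1..n. trans_prob r A k)"

lemma free_insert: "1 \<le> k \<Longrightarrow> free (insert k A) k = free A k"
  by (auto simp: free_def)

lemma free_cong: "A \<inter> {..k} = B \<inter> {..k} \<Longrightarrow> free A k = free B k"
  unfolding free_def by (drule arg_cong[where f = "\<lambda>S. k div 2 \<in> S"]) simp

lemma mem_cong: fixes k :: nat shows "A \<inter> {..k} = B \<inter> {..k} \<Longrightarrow> k \<in> A \<longleftrightarrow> k \<in> B"
  by (drule arg_cong[where f = "\<lambda>S. k \<in> S"]) simp

lemma trans_prob_cong:
  assumes "A \<inter> {..k} = B \<inter> {..k}"
  shows "trans_prob r A k = trans_prob r B k"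
proof -
  have "k \<in> A \<longleftrightarrow> k \<in> B" "k div 2 \<in> A \<longleftrightarrow> k div 2 \<in> B"
    using assms by (metis IntD1 IntI atMost_iff le_refl, metis IntD1 IntI atMost_iff div_le_dividend)
  then show ?thesis by (simp add: trans_prob_def free_def)
qed

lemma weight_cong:
  assumes "A \<inter> {1..n} = B \<inter> {1..n}"
  shows "weight r n A = weight r n B"
  unfolding weight_def
proof (rule prod.cong[OF refl])
  fix k assume k: "k \<in> {1..n}"
  have *: "i \<in> A \<longleftrightarrow> i \<in> B" if "1 \<le> i" "i \<le> n" for i
    using assms that by (metis IntD1 IntI atLeastAtMost_iff)
  have "free A k = free B k"
    unfolding free_def using k by (cases "even k") (auto simp: *)
  then show "trans_prob r A k = trans_prob r B k"
    using k by (simp add: trans_prob_def *)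
qed

lemma weight_restrict: "weight r n (A \<inter> {1..n}) = weight r n A"
  by (rule weight_cong) auto

lemma trans_prob_nonneg: "0 \<le> r k \<Longrightarrow> r k \<le> 1 \<Longrightarrow> 0 \<le> trans_prob r A k"
  by (simp add: trans_prob_def)

lemma weight_nonneg: "(\<And>k. 1 \<le> k \<Longrightarrow> 0 \<le> r k \<and> r k \<le> 1) \<Longrightarrow> 0 \<le> weight r n A"
  unfolding weight_def by (intro prod_nonneg) (auto intro: trans_prob_nonneg)

lemma admissible_if_weight_nonzero:
  assumes "weight r n A \<noteq> 0" "A \<subseteq> {1..n}"
  shows "admissible A"
  unfolding admissible_def
proof (intro allI impI notI)
  fix k assume k: "1 \<le> k" "k \<in> A" "2 * k \<in> A"
  then have "trans_prob r A (2 * k) = 0" by (simp add: trans_prob_def free_def)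
  moreover have "2 * k \<in> {1..n}" using k assms(2) by auto
  ultimately show False using assms(1) by (auto simp: weight_def)
qed

lemma admissible_free:
  assumes "admissible A" "k \<in> A" "1 \<le> k"
  shows "free A k"
proof (rule ccontr)
  assume "\<not> free A k"
  then have e: "even k" "k div 2 \<in> A" by (auto simp: free_def)
  then have "1 \<le> k div 2" "2 * (k div 2) = k" using assms(3) by auto
  then show False using assms(1,2) e(2) by (auto simp: admissible_def)
qed

lemma sum_Pow_Suc:
  fixes f :: "nat set \<Rightarrow> 'b::comm_monoid_add"
  shows "(\<Sum>A\<in>Pow {1..Suc n}. f A) = (\<Sum>A\<in>Pow {1..n}. f A + f (insert (Suc n) A))"
proof -
  have P: "Pow {1..Suc n} = Pow {1..n} \<union> insert (Suc n) ` Pow {1..n}"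
    by (simp add: atLeastAtMostSuc_conv Pow_insert)
  have d: "Pow {1..n} \<inter> insert (Suc n) ` Pow {1..n} = {}" by auto
  have i: "inj_on (insert (Suc n)) (Pow {1..n})"
    by (rule inj_onI) (metis Pow_iff Suc_n_not_le_n atLeastAtMost_iff insert_ident subset_iff)
  show ?thesis
    unfolding P using sum.union_disjoint[OF _ _ d, of f]
    by (simp only: sum.reindex[OF i] sum.distrib o_def finite_imageI finite_Pow_iff finite_atLeastAtMost simp_thms True_implies_equals)
qed

text \<open>This replaces the tower property of conditional expectations: if \<open>F k\<close> depends on the first
  \<open>k\<close> digits only and has conditional mean at most \<open>G k\<close> given the earlier ones, then the mean of the
  product of the \<open>F k\<close> is at most the product of the \<open>G k\<close>. It gives the total mass, exponential
  moments and the mean of likelihood ratios.\<close>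

lemma sum_weight_prod_le:
  assumes r: "\<And>k. 1 \<le> k \<Longrightarrow> 0 \<le> r k \<and> r k \<le> 1"
    and F0: "\<And>k A. 1 \<le> k \<Longrightarrow> 0 \<le> F k A"
    and local: "\<And>k A B. A \<inter> {..k} = B \<inter> {..k} \<Longrightarrow> F k A = F k B"
    and fr: "\<And>k A. 1 \<le> k \<Longrightarrow> free A k \<Longrightarrow> k \<notin> A \<Longrightarrow>
       (1 - r k) * F k A + r k * F k (insert k A) \<le> G k"
    and forced: "\<And>k A. 1 \<le> k \<Longrightarrow> \<not> free A k \<Longrightarrow> k \<notin> A \<Longrightarrow> F k A \<le> G k"
  shows "(\<Sum>A\<in>Pow {1..n}. weight r n A * (\<Prod>k=1..n. F k A)) \<le> (\<Prod>k=1..n. G k)"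
proof (induction n)
  case 0
  then show ?case by (simp add: weight_def)
next
  case (Suc n)
  let ?k = "Suc n"
  define v where "v = (\<lambda>A. weight r n A * (\<Prod>k=1..n. F k A))"
  have step: "trans_prob r A ?k * F ?k A + trans_prob r (insert ?k A) ?k * F ?k (insert ?k A) \<le> G ?k"
    if "A \<in> Pow {1..n}" for A
  proof -
    have kA: "?k \<notin> A" using that by auto
    have neq: "?k div 2 \<noteq> ?k" by simp
    have fi: "free (insert ?k A) ?k = free A ?k" using neq by (auto simp: free_def)
    show ?thesis
      using fr[of ?k A] forced[of ?k A] kA fi by (cases "free A ?k") (auto simp: trans_prob_def)
  qed
  have v0: "0 \<le> v A" for A
    unfolding v_def using F0 by (intro mult_nonneg_nonneg weight_nonneg r prod_nonneg) auto
  have ins: "v (insert ?k A) = v A" if "A \<in> Pow {1..n}" for A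
  proof -
    have *: "insert ?k A \<inter> {..k} = A \<inter> {..k}" if "k \<in> {1..n}" for k using that by auto
    show ?thesis
      unfolding v_def weight_def
      by (intro arg_cong2[where f = "(*)"] prod.cong refl trans_prob_cong local *) auto
  qed
  have G0: "0 \<le> G ?k"
  proof -
    have "0 \<le> (1 - r ?k) * F ?k {} + r ?k * F ?k {?k}"
      using r[of ?k] F0[of ?k] by (intro add_nonneg_nonneg mult_nonneg_nonneg) auto
    also have "\<dots> \<le> G ?k" using fr[of ?k "{}"] by (simp add: free_def)
    finally show ?thesis .
  qed
  have "(\<Sum>A\<in>Pow {1..Suc n}. weight r (Suc n) A * (\<Prod>k=1..Suc n. F k A))
      = (\<Sum>A\<in>Pow {1..Suc n}. v A * (trans_prob r A ?k * F ?k A))"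
    by (simp add: v_def weight_def mult_ac)
  also have "\<dots> = (\<Sum>A\<in>Pow {1..n}. v A *
      (trans_prob r A ?k * F ?k A + trans_prob r (insert ?k A) ?k * F ?k (insert ?k A)))"
    unfolding sum_Pow_Suc by (intro sum.cong refl) (simp add: ins ring_distribs)
  also have "\<dots> \<le> (\<Sum>A\<in>Pow {1..n}. v A * G ?k)"
    by (intro sum_mono mult_left_mono step v0)
  also have "\<dots> \<le> (\<Prod>k=1..n. G k) * G ?k"
    using Suc.IH G0 unfolding v_def sum_distrib_right[symmetric] by (intro mult_right_mono)
  finally show ?case by simp
qed

lemma sum_weight_le_1:
  assumes "\<And>k. 1 \<le> k \<Longrightarrow> 0 \<le> r k \<and> r k \<le> 1"
  shows "(\<Sum>A\<in>Pow {1..n}. weight r n A) \<le> 1"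
  using sum_weight_prod_le[of r "\<lambda>_ _. 1" "\<lambda>_. 1" n] assms by simp

text \<open>The even positions up to \<open>n\<close> are the children of the positions up to \<open>n div 2\<close>. All
  recursions between scales \<open>n\<close> and \<open>n div 2\<close> come from here.\<close>

lemma sum_parent: "(\<Sum>k=1..n. parent f k) = (\<Sum>k=1..n div 2. f k)"
proof (induction n)
  case (Suc n)
  show ?case
  proof (cases "even n")
    case True
    then have "Suc n div 2 = n div 2" by auto
    then show ?thesis using Suc True by (simp add: parent_def)
  next
    case False
    then have "Suc n div 2 = Suc (n div 2)" by (auto elim!: oddE)
    then show ?thesis using Suc False by (simp add: parent_def)
  qed
qed simp

lemma of_bool_free: "of_bool (free A k) = 1 - parent (\<lambda>k. of_bool (k \<in> A)) k"
  by (simp add: free_def parent_def)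

lemma sum_free: "(\<Sum>k=1..n. of_bool (free A k)) = real n - ones A (n div 2)"
  unfolding of_bool_free sum_subtractf sum_parent ones_def by (simp del: sum_of_bool_eq)

lemma ones_nonneg: "0 \<le> ones A n"
  unfolding ones_def by (intro sum_nonneg) auto

lemma ones_le: "ones A n \<le> real n"
  unfolding ones_def using sum_bounded_above[of "{1..n}" "\<lambda>k. of_bool (k \<in> A)" "1 :: real"] by simp

lemma ones_le_free:
  assumes "admissible A"
  shows "0 \<le> real n - ones A n - ones A (n div 2)"
proof -
  have "ones A n \<le> (\<Sum>k=1..n. of_bool (free A k))"
    unfolding ones_def by (intro sum_mono) (auto intro: admissible_free[OF assms])
  then show ?thesis by (simp only: sum_free)
qed

text \<open>The last coefficient counts the free zeros: \<open>n - ones A (n div 2)\<close> digits are free, among them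
  every digit that is equal to one.\<close>

lemma weight_const:
  assumes "admissible A" "0 < \<rho>" "\<rho> < 1"
  shows "weight (\<lambda>_. \<rho>) n A =
    exp (ones A n * ln \<rho> + (real n - ones A n - ones A (n div 2)) * ln (1 - \<rho>))"
proof -
  have "trans_prob (\<lambda>_. \<rho>) A k =
      exp (of_bool (k \<in> A) * ln \<rho> + (of_bool (free A k) - of_bool (k \<in> A)) * ln (1 - \<rho>))"
    if "1 \<le> k" for k
    using admissible_free[OF assms(1) _ that] assms(2,3) by (auto simp: trans_prob_def)
  then have "weight (\<lambda>_. \<rho>) n A = (\<Prod>k=1..n. 
      exp (of_bool (k \<in> A) * ln \<rho> + (of_bool (free A k) - of_bool (k \<in> A)) * ln (1 - \<rho>)))"
    unfolding weight_def by (intro prod.cong) auto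
  also have "\<dots> = exp ((\<Sum>k=1..n. of_bool (k \<in> A)) * ln \<rho> +
      ((\<Sum>k=1..n. of_bool (free A k)) - (\<Sum>k=1..n. of_bool (k \<in> A))) * ln (1 - \<rho>))"
    by (simp only: exp_sum[symmetric, OF finite_atLeastAtMost] sum.distrib sum_distrib_right[symmetric] sum_subtractf)
  also have "\<dots> = exp (ones A n * ln \<rho> + (real n - ones A n - ones A (n div 2)) * ln (1 - \<rho>))"
    unfolding sum_free ones_def[symmetric] by (simp add: algebra_simps)
  finally show ?thesis .
qed

section \<open>Binary coding\<close>

definition point :: "nat set \<Rightarrow> real" where
  "point A = (\<Sum>k. of_bool (Suc k \<in> A) / 2 ^ Suc k)"

definition prefix_value :: "nat \<Rightarrow> nat set \<Rightarrow> real" where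
  "prefix_value n A = (\<Sum>k=1..n. of_bool (k \<in> A) / 2 ^ k)"

lemma Xi_G_eq: "Xi_G = point ` Collect admissible"
proof safe
  fix x assume "x \<in> Xi_G"
  then obtain b :: "nat \<Rightarrow> nat" where b: "\<And>k. 1 \<le> k \<Longrightarrow> b k \<in> {0, 1}"
      "\<And>k. 1 \<le> k \<Longrightarrow> b k * b (2 * k) = 0" "x = (\<Sum>k. real (b (Suc k)) / 2 ^ Suc k)"
    by (auto simp: Xi_G_def)
  define A where "A = {k. 1 \<le> k \<and> b k = 1}"
  have *: "of_bool (Suc k \<in> A) = real (b (Suc k))" for k
    using b(1)[of "Suc k"] by (auto simp: A_def)
  have "admissible A" using b(2) by (fastforce simp: admissible_def A_def)
  moreover have "point A = x" unfolding point_def * b(3) ..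
  ultimately show "x \<in> point ` Collect admissible" by blast
next
  fix A assume A: "admissible A"
  define b :: "nat \<Rightarrow> nat" where "b = (\<lambda>k. of_bool (k \<in> A))"
  have "point A = (\<Sum>k. real (b (Suc k)) / 2 ^ Suc k)"
    by (simp add: point_def b_def)
  moreover have "\<forall>k\<ge>1. b k \<in> {0, 1}" "\<forall>k\<ge>1. b k * b (2 * k) = 0"
    using A by (auto simp: b_def admissible_def)
  ultimately show "point A \<in> Xi_G" unfolding Xi_G_def by blast
qed

lemma point_bounds: "prefix_value n A \<le> point A" "point A \<le> prefix_value n A + 1 / 2 ^ n"
proof -
  define f :: "nat \<Rightarrow> real" where "f = (\<lambda>k. of_bool (Suc k \<in> A) / 2 ^ Suc k)"
  have f: "0 \<le> f k" "f k \<le> (1/2) ^ Suc k" for k by (auto simp: f_def power_one_over)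
  have geo: "(\<lambda>k. (1/2) ^ Suc (k + n) :: real) sums (1 / 2 ^ n)"
    using sums_mult[OF power_half_series, of "(1/2)^n"] by (simp add: power_add power_one_over mult_ac)
  have sf: "summable f"
    by (rule summable_comparison_test'[OF sums_summable[OF power_half_series]]) (use f in auto)
  have P: "prefix_value n A = (\<Sum>k<n. f k)"
    unfolding prefix_value_def f_def
    by (rule sum.reindex_bij_witness[of _ Suc "\<lambda>k. k - 1"]) auto
  have split: "point A = (\<Sum>k. f (k + n)) + (\<Sum>k<n. f k)"
    unfolding point_def f_def[symmetric] by (rule suminf_split_initial_segment[OF sf])
  have st: "summable (\<lambda>k. f (k + n))" using sf by (simp add: summable_iff_shift)
  have "0 \<le> (\<Sum>k. f (k + n))" by (rule suminf_nonneg[OF st]) (rule f)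
  then show "prefix_value n A \<le> point A" using split P by simp
  have "(\<Sum>k. f (k + n)) \<le> (\<Sum>k. (1/2) ^ Suc (k + n))"
    by (rule suminf_le[OF _ st sums_summable[OF geo]]) (rule f)
  also have "\<dots> = 1 / 2 ^ n" using sums_unique[OF geo] by simp
  finally show "point A \<le> prefix_value n A + 1 / 2 ^ n" using split P by simp
qed

lemma prefix_value_cong:
  assumes "A \<inter> {1..n} = B \<inter> {1..n}"
  shows "prefix_value n A = prefix_value n B"
  unfolding prefix_value_def
proof (rule sum.cong[OF refl])
  fix k assume "k \<in> {1..n}"
  then have "k \<in> A \<longleftrightarrow> k \<in> B" using assms by blast
  then show "of_bool (k \<in> A) / 2 ^ k = (of_bool (k \<in> B) / 2 ^ k :: real)" by simp
qed

definition cylinder :: "nat \<Rightarrow> nat set \<Rightarrow> real set" where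
  "cylinder n A = {prefix_value n A .. prefix_value n A + 1 / 2 ^ n}"

lemma point_in_cylinder: "point A \<in> cylinder n A"
  using point_bounds[where n = n and A = A] by (simp add: cylinder_def)

lemma cylinder_restrict: "cylinder n (A \<inter> {1..n}) = cylinder n A"
  unfolding cylinder_def by (subst (1 2) prefix_value_cong[of _ _ A]) auto

definition prefixes :: "nat \<Rightarrow> real set \<Rightarrow> nat set set" where
  "prefixes n U = (\<lambda>A. A \<inter> {1..n}) ` {A. admissible A \<and> point A \<in> U}"

text \<open>Scaled by \<open>2 ^ n\<close>, the value of a prefix is an integer whose binary digits are the
  reversed word, so distinct words have distinct values.\<close>

lemma prefix_value_eq_set_encode:
  assumes "A \<subseteq> {1..n}"
  shows "2 ^ n * prefix_value n A = real (set_encode ((\<lambda>k. n - k) ` A))"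
proof -
  have "2 ^ n * prefix_value n A = (\<Sum>k=1..n. if k \<in> A then 2 ^ (n - k) else 0)"
    unfolding prefix_value_def sum_distrib_left
    by (intro sum.cong refl) (auto simp: power_diff)
  also have "\<dots> = (\<Sum>k\<in>A. 2 ^ (n - k))"
    using assms by (simp add: sum.inter_restrict[symmetric] Int_absorb1)
  also have "\<dots> = (\<Sum>i\<in>(\<lambda>k. n - k) ` A. 2 ^ i)"
  proof -
    have "inj_on (\<lambda>k. n - k) A"
      using assms by (intro inj_onI) (metis atLeastAtMost_iff diff_diff_cancel subset_iff)
    then show ?thesis by (simp add: sum.reindex)
  qed
  finally show ?thesis by (simp add: set_encode_def)
qed

text \<open>The scaled prefix values of two points of \<open>U\<close> are integers that differ by at most two, because each
  prefix value is at most \<open>1 / 2 ^ n\<close> below its point.\<close>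

lemma card_prefixes_le:
  assumes "\<And>x y. x \<in> U \<Longrightarrow> y \<in> U \<Longrightarrow> \<bar>x - y\<bar> \<le> 1 / 2 ^ n"
  shows "card (prefixes n U) \<le> 3"
proof (cases "prefixes n U = {}")
  case False
  define code where "code = (\<lambda>A. set_encode ((\<lambda>k. n - k) ` A))"
  have fin: "finite (prefixes n U)"
    by (rule finite_subset[of _ "Pow {1..n}"]) (auto simp: prefixes_def)
  have inj: "inj_on code (prefixes n U)"
  proof (rule inj_onI)
    fix A B assume A: "A \<in> prefixes n U" and B: "B \<in> prefixes n U" and "code A = code B"
    have AB: "A \<subseteq> {1..n}" "B \<subseteq> {1..n}" using A B by (auto simp: prefixes_def)
    then have "finite A" "finite B" by (auto intro: finite_subset)
    then have "(\<lambda>k. n - k) ` A = (\<lambda>k. n - k) ` B"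
      using \<open>code A = code B\<close> set_encode_eq by (auto simp: code_def)
    moreover have "inj_on (\<lambda>k. n - k) {1..n}" by (auto simp: inj_on_def)
    ultimately show "A = B" using AB inj_on_image_eq_iff by blast
  qed
  define m where "m = Min (code ` prefixes n U)"
  have close: "code A \<le> code B + 2" if A: "A \<in> prefixes n U" and B: "B \<in> prefixes n U" for A B
  proof -
    obtain A' where A': "A = A' \<inter> {1..n}" "point A' \<in> U" using A by (auto simp: prefixes_def)
    obtain B' where B': "B = B' \<inter> {1..n}" "point B' \<in> U" using B by (auto simp: prefixes_def)
    have pv: "prefix_value n A = prefix_value n A'" "prefix_value n B = prefix_value n B'"
      unfolding A'(1) B'(1) by (rule prefix_value_cong, auto)+
    have "prefix_value n A \<le> prefix_value n B + 2 * (1 / 2 ^ n)"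
      using point_bounds[where n = n and A = A'] point_bounds[where n = n and A = B']
        assms[OF A'(2) B'(2)] unfolding pv by linarith
    then have "2 ^ n * prefix_value n A \<le> 2 ^ n * (prefix_value n B + 2 * (1 / 2 ^ n))"
      by (intro mult_left_mono) auto
    also have "\<dots> = 2 ^ n * prefix_value n B + 2" by (simp add: algebra_simps)
    finally have "real (code A) \<le> real (code B) + 2"
      using A' B' by (simp add: code_def prefix_value_eq_set_encode)
    then show ?thesis by linarith
  qed
  have "m \<in> code ` prefixes n U" unfolding m_def using fin False by (intro Min_in) auto
  then obtain B where B: "B \<in> prefixes n U" "m = code B" by auto
  have "code ` prefixes n U \<subseteq> {m..m + 2}"
  proof safe
    fix A assume A: "A \<in> prefixes n U"
    have "m \<le> code A" unfolding m_def using fin A by (intro Min_le) auto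
    then show "code A \<in> {m..m + 2}" using close[OF A B(1)] B(2) by simp
  qed
  then have "card (code ` prefixes n U) \<le> card {m..m + 2}" by (intro card_mono) auto
  then show ?thesis using card_image[OF inj] by simp
qed simp

section \<open>The stationary measure and its perturbations\<close>

lemma ln_perturbed:
  fixes x \<epsilon> :: real
  assumes "0 < x" "\<bar>\<epsilon>\<bar> \<le> x / 2"
  shows "ln x + \<epsilon> / x - 2 * (\<epsilon> / x)\<^sup>2 \<le> ln (x + \<epsilon>)"
proof -
  have z: "\<bar>\<epsilon> / x\<bar> \<le> 1 / 2" using assms by (auto simp: abs_le_iff field_simps)
  then have "ln (x * (1 + \<epsilon> / x)) = ln x + ln (1 + \<epsilon> / x)"
    using assms(1) abs_le_D2[OF z] by (intro ln_mult_pos) linarith+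
  moreover have "x * (1 + \<epsilon> / x) = x + \<epsilon>" using assms(1) by (simp add: field_simps)
  moreover have "\<epsilon> / x - 2 * (\<epsilon> / x)\<^sup>2 \<le> ln (1 + \<epsilon> / x)"
    using abs_ln_one_plus_x_minus_x_bound[OF z] by linarith
  ultimately show ?thesis by simp
qed

text \<open>The constant \<open>\<kappa>\<close> is chosen so that, after division by \<open>C\<close>, the correction
  \<open>\<kappa> (A d (m + 1) + B d m)\<close> becomes a convex combination of \<open>d (m + 1)\<close> and \<open>d m\<close>, and both inequalities telescope
  exactly. The first makes \<open>(m + \<alpha>) d m\<close> decrease by a harmonic series, so that \<open>d\<close>
  becomes negative. The second makes \<open>d m / (m + 1 - \<alpha>)\<close> decrease, so that a
  negative \<open>d\<close> tends to minus infinity linearly.\<close>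

lemma drifting_recursion_contradiction:
  fixes d :: "nat \<Rightarrow> real"
  assumes pos: "0 < C" "0 < A" "0 < B" and \<kappa>: "\<kappa> = C / (A + B)"
    and bdd: "\<And>m. \<bar>d m\<bar> \<le> 1"
    and plus: "\<And>m. m \<ge> m0 \<Longrightarrow> C * (d (Suc m) - d m) + \<kappa> / Suc m * (A * d (Suc m) + B * d m) < - 1 / (real (Suc m))\<^sup>2"
    and minus: "\<And>m. m \<ge> m0 \<Longrightarrow> C * (d (Suc m) - d m) - \<kappa> / Suc m * (A * d (Suc m) + B * d m) < - 1 / (real (Suc m))\<^sup>2"
  shows False
proof -
  define \<alpha> where "\<alpha> = A / (A + B)"
  have \<alpha>: "0 < \<alpha>" "\<alpha> < 1" using pos by (auto simp: \<alpha>_def)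
  have \<kappa>A: "\<kappa> * A = C * \<alpha>" and \<kappa>B: "\<kappa> * B = C * (1 - \<alpha>)"
    using pos by (auto simp: \<alpha>_def \<kappa> field_simps)
  define u where "u = (\<lambda>m. (real m + \<alpha>) * d m)"
  have u: "u (Suc m) < u m - 1 / C * (1 / Suc m)" if "m \<ge> m0" for m
  proof -
    have "Suc m / C * (C * (d (Suc m) - d m) + \<kappa> / Suc m * (A * d (Suc m) + B * d m)) < Suc m / C * (- 1 / (real (Suc m))\<^sup>2)"
      using pos by (intro mult_strict_left_mono plus that) auto
    moreover have "Suc m / C * (C * (d (Suc m) - d m) + \<kappa> / Suc m * (A * d (Suc m) + B * d m))
        = Suc m * (d (Suc m) - d m) + (\<kappa> * A * d (Suc m) + \<kappa> * B * d m) / C"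
      using pos by (simp add: field_simps del: of_nat_Suc)
    moreover have "(\<kappa> * A * d (Suc m) + \<kappa> * B * d m) / C = \<alpha> * d (Suc m) + (1 - \<alpha>) * d m"
      unfolding \<kappa>A \<kappa>B using pos by (simp add: field_simps)
    moreover have "Suc m / C * (- 1 / (real (Suc m))\<^sup>2) = - (1 / C * (1 / Suc m))"
      by (simp add: power2_eq_square del: of_nat_Suc)
    ultimately show ?thesis unfolding u_def by (simp add: algebra_simps)
  qed
  have "\<exists>m1\<ge>m0. d m1 < 0"
  proof (rule ccontr)
    assume a: "\<not> (\<exists>m1\<ge>m0. d m1 < 0)"
    then have d0: "0 \<le> d m" if "m \<ge> m0" for m using that by (meson not_less)
    have le: "(\<Sum>i<n. 1 / C * (1 / Suc (i + m0))) \<le> u m0 - u (n + m0)" for n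
    proof (induction n)
      case (Suc n)
      then show ?case using u[of "n + m0"] by simp
    qed simp
    have "0 \<le> u (n + m0)" for n using d0[of "n + m0"] \<alpha> by (simp add: u_def)
    then have "(\<Sum>i<n. 1 / C * (1 / Suc (i + m0))) \<le> u m0" for n
      using le[of n] by (smt (verit))
    then have "summable (\<lambda>i. 1 / C * (1 / real (Suc (i + m0))))"
      using pos by (intro summableI_nonneg_bounded) auto
    then have "summable (\<lambda>i. C * (1 / C * (1 / real (Suc (i + m0)))))" by (rule summable_mult)
    then have "summable (\<lambda>i. 1 / real (i + Suc m0))" using pos by simp
    then have "summable (\<lambda>i. 1 / real i)" 
      by (subst (asm) summable_iff_shift[of "\<lambda>i. 1 / real i"])
    then show False using not_summable_harmonic[where ?'a = real] by (simp add: inverse_eq_divide)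
  qed
  then obtain m1 where m1: "m1 \<ge> m0" "d m1 < 0" by blast
  define h where "h = (\<lambda>m. d m / (real m + 1 - \<alpha>))"
  have h: "h (Suc m) \<le> h m" if "m \<ge> m0" for m
  proof -
    have "Suc m / C * (C * (d (Suc m) - d m) - \<kappa> / Suc m * (A * d (Suc m) + B * d m)) < Suc m / C * (- 1 / (real (Suc m))\<^sup>2)"
      using pos by (intro mult_strict_left_mono minus that) auto
    moreover have "Suc m / C * (C * (d (Suc m) - d m) - \<kappa> / Suc m * (A * d (Suc m) + B * d m))
        = Suc m * (d (Suc m) - d m) - (\<kappa> * A * d (Suc m) + \<kappa> * B * d m) / C"
      using pos by (simp add: field_simps del: of_nat_Suc)
    moreover have "(\<kappa> * A * d (Suc m) + \<kappa> * B * d m) / C = \<alpha> * d (Suc m) + (1 - \<alpha>) * d m"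
      unfolding \<kappa>A \<kappa>B using pos by (simp add: field_simps)
    moreover have "Suc m / C * (- 1 / (real (Suc m))\<^sup>2) < 0"
      using pos by (simp add: field_simps)
    ultimately have "(real m + 1 - \<alpha>) * d (Suc m) \<le> (real m + 2 - \<alpha>) * d m"
      by (simp add: algebra_simps)
    then show ?thesis using \<alpha> by (simp add: h_def field_simps)
  qed
  have hle: "h (n + m1) \<le> h m1" for n
  proof (induction n)
    case (Suc n)
    then show ?case using h[of "n + m1"] m1 by simp
  qed simp
  have h0: "h m1 < 0" using m1 \<alpha> by (simp add: h_def divide_neg_pos)
  obtain n where n: "1 / (- h m1) < real n" using reals_Archimedean2 by blast
  have "1 < real n * (- h m1)" using n h0 by (simp add: field_simps)
  also have "\<dots> \<le> (real (n + m1) + 1 - \<alpha>) * (- h m1)"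
    using h0 \<alpha> by (intro mult_right_mono) auto
  also have "\<dots> \<le> (real (n + m1) + 1 - \<alpha>) * (- h (n + m1))"
    using hle[of n] \<alpha> by (intro mult_left_mono) auto
  also have "\<dots> = - d (n + m1)" using \<alpha> by (simp add: h_def)
  finally show False using bdd[of "n + m1"] by simp
qed

locale golden =
  fixes p q :: real
  assumes p_pos: "0 < p" and p_less_1: "p < 1" and q_eq: "q = 1 - p" and pq: "p ^ 3 = q ^ 2"
begin

definition s where "s = - ln p / ln 2"

lemma q_pos: "0 < q" and q_less_1: "q < 1" and ln_p_neg: "ln p < 0"
  using p_pos p_less_1 q_eq by auto

lemma ln_q: "ln q = 3 / 2 * ln p"
proof -
  have "ln (p ^ 3) = ln (q ^ 2)" using pq by simp
  then show ?thesis using p_pos q_pos by (simp add: ln_realpow)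
qed

lemma s_pos: "0 < s" using ln_p_neg by (simp add: s_def field_simps)

lemma two_powr_s: "(1 / 2 ^ n) powr s = exp (real n * ln p)"
  by (simp add: powr_def s_def ln_div ln_realpow)

text \<open>In powers of \<open>p\<close>, a free zero counts \<open>1\<close>. By \<open>p\<^sup>3 = q\<^sup>2\<close> a one counts \<open>3 / 2\<close>, and the forced
  zeros, one for each one up to \<open>n div 2\<close>, count \<open>0\<close>.\<close>

lemma weight_q:
  assumes "admissible A"
  shows "weight (\<lambda>_. q) n A = exp (ln p * (real n + (ones A n / 2 - ones A (n div 2))))"
proof -
  have *: "1 - q = p" by (simp add: q_eq)
  show ?thesis
    unfolding weight_const[OF assms q_pos q_less_1, of n] ln_q * by (simp add: algebra_simps)
qed

text \<open>The limiting density of ones under the stationary measure: the solution \<open>a\<close> of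
  \<open>a = q (1 - a / 2)\<close>, because a fraction \<open>1 - a / 2\<close> of the digits is free.\<close>

definition density where "density = 2 * q / (2 + q)"

lemma density_bounds: "0 < density" "density < 1"
  using q_pos q_less_1 by (auto simp: density_def)

definition deviation where "deviation A J = density - ones A (2 ^ J) / 2 ^ J"

lemma deviation_bound: "\<bar>deviation A J\<bar> \<le> 1"
proof -
  have "0 \<le> ones A (2 ^ J) / 2 ^ J" "ones A (2 ^ J) / 2 ^ J \<le> 1"
    using ones_le[of A "2 ^ J"] ones_nonneg[of A "2 ^ J"] by auto
  then show ?thesis using density_bounds unfolding deviation_def abs_le_iff by linarith
qed

text \<open>The first-order term in \<open>\<epsilon>\<close> has no constant part, because \<open>density\<close> is where the
  derivative of the mean log-weight in the transition probability vanishes.\<close>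

lemma weight_perturbed:
  assumes A: "admissible A" and \<epsilon>: "\<bar>\<epsilon>\<bar> \<le> p / 2" "\<bar>\<epsilon>\<bar> \<le> q / 2"
  shows "exp (2 ^ Suc J * (ln p + (- ln p / 2) * (deviation A (Suc J) - deviation A J) +
      \<epsilon> * ((1 / q + 1 / p) * deviation A (Suc J) + 1 / (2 * p) * deviation A J)
      - 2 * (1 / q\<^sup>2 + 1 / p\<^sup>2) * \<epsilon>\<^sup>2)) \<le> weight (\<lambda>_. q - \<epsilon>) (2 ^ Suc J) A"
proof -
  define n :: nat where "n = 2 ^ Suc J"
  have half: "n div 2 = 2 ^ J" and n: "real n = 2 ^ Suc J" by (auto simp: n_def)
  define x where "x = ones A n / n"
  define y where "y = ones A (n div 2) / n"
  have x: "x = density - deviation A (Suc J)" by (simp add: x_def deviation_def n_def)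
  have y: "y = (density - deviation A J) / 2" by (simp add: y_def deviation_def half n)
  have n0: "0 < real n" by (simp add: n)
  have x0: "0 \<le> x" using ones_nonneg[of A n] by (simp add: x_def)
  have "0 \<le> (real n - ones A n - ones A (n div 2)) / n"
    using ones_le_free[OF A, of n] by simp
  then have z0: "0 \<le> 1 - x - y" using n0 by (simp add: x_def y_def diff_divide_distrib)
  have y0: "0 \<le> y" using ones_nonneg[of A "n div 2"] by (simp add: y_def)
  have W: "weight (\<lambda>_. q - \<epsilon>) n A = exp (n * (x * ln (q - \<epsilon>) + (1 - x - y) * ln (p + \<epsilon>)))"
  proof -
    have "0 < q - \<epsilon>" "q - \<epsilon> < 1" "1 - (q - \<epsilon>) = p + \<epsilon>"
      using \<epsilon> p_pos q_pos q_eq by (auto simp: abs_le_iff)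
    moreover have "ones A n = n * x" "ones A (n div 2) = n * y" using n0 by (auto simp: x_def y_def)
    ultimately show ?thesis using weight_const[OF A, of "q - \<epsilon>" n]
      by (simp only:) (simp add: algebra_simps)
  qed
  define D where "D = deviation A (Suc J)"
  define E where "E = deviation A J"
  have lq: "ln q - \<epsilon> / q - 2 * (\<epsilon> / q)\<^sup>2 \<le> ln (q - \<epsilon>)"
    using ln_perturbed[OF q_pos, of "-\<epsilon>"] \<epsilon> by simp
  have lp: "ln p + \<epsilon> / p - 2 * (\<epsilon> / p)\<^sup>2 \<le> ln (p + \<epsilon>)"
    using ln_perturbed[OF p_pos, of "\<epsilon>"] \<epsilon> by simp
  have "x * (ln q - \<epsilon> / q - 2 * (\<epsilon> / q)\<^sup>2) + (1 - x - y) * (ln p + \<epsilon> / p - 2 * (\<epsilon> / p)\<^sup>2)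
      \<le> x * ln (q - \<epsilon>) + (1 - x - y) * ln (p + \<epsilon>)"
    by (intro add_mono mult_left_mono lq lp x0 z0)
  moreover have "x * (ln q - \<epsilon> / q - 2 * (\<epsilon> / q)\<^sup>2) + (1 - x - y) * (ln p + \<epsilon> / p - 2 * (\<epsilon> / p)\<^sup>2)
     = ln p + ln p * (x / 2 - y) + \<epsilon> * (1 / p - x * (1 / q + 1 / p) - y / p)
       - (x * (2 * (\<epsilon> / q)\<^sup>2) + (1 - x - y) * (2 * (\<epsilon> / p)\<^sup>2))"
    by (simp add: ln_q algebra_simps add_divide_distrib)
  moreover have "ln p * (x / 2 - y) = (- ln p / 2) * (D - E)" by (simp add: x y D_def E_def field_simps)
  moreover have "1 / p - x * (1 / q + 1 / p) - y / p = (1 / q + 1 / p) * D + 1 / (2 * p) * E"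
  proof -
    have "1 / q + 1 / p = 1 / (p * q)" using p_pos q_pos q_eq by (simp add: field_simps)
    moreover have "1 / p - density * (1 / (p * q)) - density / (2 * p) = (2 * q - density * (2 + q)) / (2 * p * q)"
      using p_pos q_pos by (simp add: field_simps)
    moreover have "density * (2 + q) = 2 * q" using q_pos by (simp add: density_def)
    ultimately have "1 / p - density * (1 / q + 1 / p) - density / (2 * p) = 0" by simp
    moreover have "1 / p - x * (1 / q + 1 / p) - y / p = (1 / q + 1 / p) * D + 1 / (2 * p) * E +
        (1 / p - density * (1 / q + 1 / p) - density / (2 * p))"
      by (simp add: x y D_def[symmetric] E_def[symmetric] algebra_simps diff_divide_distrib)
    ultimately show ?thesis by simp
  qed
  moreover have "x * (2 * (\<epsilon> / q)\<^sup>2) + (1 - x - y) * (2 * (\<epsilon> / p)\<^sup>2) \<le> 2 * (1 / q\<^sup>2 + 1 / p\<^sup>2) * \<epsilon>\<^sup>2"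
  proof -
    have "x * (2 * (\<epsilon> / q)\<^sup>2) + (1 - x - y) * (2 * (\<epsilon> / p)\<^sup>2) \<le> 1 * (2 * (\<epsilon> / q)\<^sup>2) + 1 * (2 * (\<epsilon> / p)\<^sup>2)"
      using x0 y0 z0 by (intro add_mono mult_right_mono) auto
    then show ?thesis by (simp add: power_divide algebra_simps)
  qed
  moreover from calculation(4) have "\<epsilon> * (1 / p - x * (1 / q + 1 / p) - y / p) = \<epsilon> * ((1 / q + 1 / p) * D + 1 / (2 * p) * E)"
    by simp
  ultimately have "ln p + (- ln p / 2) * (D - E) + \<epsilon> * ((1 / q + 1 / p) * D + 1 / (2 * p) * E)
      - 2 * (1 / q\<^sup>2 + 1 / p\<^sup>2) * \<epsilon>\<^sup>2 \<le> x * ln (q - \<epsilon>) + (1 - x - y) * ln (p + \<epsilon>)"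
    by linarith
  then have "exp (n * (ln p + (- ln p / 2) * (D - E) + \<epsilon> * ((1 / q + 1 / p) * D + 1 / (2 * p) * E)
      - 2 * (1 / q\<^sup>2 + 1 / p\<^sup>2) * \<epsilon>\<^sup>2)) \<le> weight (\<lambda>_. q - \<epsilon>) n A"
    unfolding W using n0 by simp
  then show ?thesis unfolding D_def E_def n_def by simp
qed

end

section \<open>Measure zero for the larger corrections\<close>

text \<open>The right-hand side is the exponent per digit of the gauge correction at \<open>t = 1 / 2 ^ n\<close> with \<open>n = 2 ^ J\<close>,
  where \<open>ln \<bar>ln t\<bar> = J ln 2 + ln (ln 2)\<close>.\<close>

lemma gauge_exponent_dominates:
  fixes \<theta> K :: real
  assumes "\<theta> < 2"
  shows "\<forall>\<^sub>F J in sequentially. K / (real J)\<^sup>2 \<le> ln 2 / (real J * ln 2 + ln (ln 2)) powr \<theta>"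
proof -
  have "(\<lambda>J. (K / (real J)\<^sup>2) / (ln 2 / (real J * ln 2 + ln (ln 2)) powr \<theta>)) \<longlonglongrightarrow> 0"
    using assms by real_asymp
  then have "\<forall>\<^sub>F J in sequentially. (K / (real J)\<^sup>2) / (ln 2 / (real J * ln 2 + ln (ln 2)) powr \<theta>) < 1"
    by (rule order_tendstoD) simp
  moreover have "\<forall>\<^sub>F J in sequentially. real J * ln 2 + ln (ln 2) > 0" by real_asymp
  ultimately show ?thesis
  proof eventually_elim
    case (elim J)
    then have "0 < ln 2 / (real J * ln 2 + ln (ln 2)) powr \<theta>" by simp
    from divide_less_eq_1_pos[OF this, THEN iffD1, OF elim(1)] show ?case by simp
  qed
qed

context golden begin

lemma heavy_prefix_exists:
  assumes "admissible A" and \<kappa>: "\<kappa> = (- ln p / 2) / ((1 / q + 1 / p) + 1 / (2 * p))"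
    and small: "\<And>J. J \<ge> m0 \<Longrightarrow> \<kappa> / Suc J \<le> p / 2" "\<And>J. J \<ge> m0 \<Longrightarrow> \<kappa> / Suc J \<le> q / 2"
    and w: "\<And>J. J \<ge> m0 \<Longrightarrow> 2 * (1 / q\<^sup>2 + 1 / p\<^sup>2) * (\<kappa> / Suc J)\<^sup>2 + 1 / (real (Suc J))\<^sup>2 \<le> w (Suc J)"
  shows "\<exists>J\<ge>m0. \<exists>\<epsilon>\<in>{\<kappa> / Suc J, - \<kappa> / Suc J}.
    exp (2 ^ Suc J * (ln p - w (Suc J))) \<le> weight (\<lambda>_. q - \<epsilon>) (2 ^ Suc J) A"
proof (rule ccontr)
  assume not: "\<not> ?thesis"
  have \<kappa>0: "0 < \<kappa>" unfolding \<kappa> using p_pos q_pos ln_p_neg by (intro divide_pos_pos add_pos_pos) simp_all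
  have neg: "(- ln p / 2) * (deviation A (Suc J) - deviation A J) +
      \<epsilon> * ((1 / q + 1 / p) * deviation A (Suc J) + 1 / (2 * p) * deviation A J) < - 1 / (real (Suc J))\<^sup>2"
    if J: "J \<ge> m0" and \<epsilon>: "\<epsilon> \<in> {\<kappa> / Suc J, - \<kappa> / Suc J}" for J \<epsilon>
  proof -
    have \<epsilon>abs: "\<bar>\<epsilon>\<bar> = \<kappa> / Suc J" using \<epsilon> divide_pos_pos[OF \<kappa>0, of "Suc J"]
      by (auto simp: abs_if simp del: of_nat_Suc)
    then have \<epsilon>2: "\<epsilon>\<^sup>2 = (\<kappa> / Suc J)\<^sup>2" by (metis power2_abs)
    have "weight (\<lambda>_. q - \<epsilon>) (2 ^ Suc J) A < exp (2 ^ Suc J * (ln p - w (Suc J)))"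
      using not J \<epsilon> by (meson not_le)
    with weight_perturbed[OF assms(1), of \<epsilon> J] \<epsilon>abs small[OF J]
    have "exp (2 ^ Suc J * (ln p + (- ln p / 2) * (deviation A (Suc J) - deviation A J) +
      \<epsilon> * ((1 / q + 1 / p) * deviation A (Suc J) + 1 / (2 * p) * deviation A J)
      - 2 * (1 / q\<^sup>2 + 1 / p\<^sup>2) * \<epsilon>\<^sup>2)) < exp (2 ^ Suc J * (ln p - w (Suc J)))"
      by linarith
    then show ?thesis using w[OF J] unfolding \<epsilon>2 exp_less_cancel_iff
      by (subst (asm) mult_less_cancel_left_pos) (simp, linarith)
  qed
  show False
  proof (rule drifting_recursion_contradiction[of "- ln p / 2" "1 / q + 1 / p" "1 / (2 * p)" \<kappa>
        "deviation A" m0])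
    show "0 < - ln p / 2" "0 < 1 / q + 1 / p" "0 < 1 / (2 * p)"
      using ln_p_neg p_pos q_pos by (auto intro: add_pos_pos)
  next
    fix m assume m: "m0 \<le> m"
    show "- ln p / 2 * (deviation A (Suc m) - deviation A m) + \<kappa> / Suc m *
        ((1 / q + 1 / p) * deviation A (Suc m) + 1 / (2 * p) * deviation A m) < - 1 / (real (Suc m))\<^sup>2"
      using neg[OF m, of "\<kappa> / Suc m"] by simp
    show "- ln p / 2 * (deviation A (Suc m) - deviation A m) - \<kappa> / Suc m *
        ((1 / q + 1 / p) * deviation A (Suc m) + 1 / (2 * p) * deviation A m) < - 1 / (real (Suc m))\<^sup>2"
      using neg[OF m, of "- \<kappa> / Suc m"] by simp
  qed (use \<kappa> deviation_bound in auto)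
qed

text \<open>At scale \<open>n = 2 ^ J\<close> the gauge equals \<open>exp (n (ln p - w J))\<close>. The heavy words satisfy the
  lower bound with \<open>w J / 2\<close> in place of \<open>w J\<close>, and the remaining factor \<open>exp (- n w J / 2)\<close> makes the sum
  over all scales converge.\<close>

lemma hausdorff_measure_Xi_G_null:
  assumes \<theta>: "\<theta> < 2"
  shows "hausdorff_measure (\<lambda>t. t powr s * exp (- (\<bar>ln t\<bar> / (ln \<bar>ln t\<bar>) powr \<theta>))) Xi_G = 0"
    (is "hausdorff_measure ?\<psi> _ = 0")
proof -
  define w where "w = (\<lambda>J::nat. ln 2 / (real J * ln 2 + ln (ln 2)) powr \<theta>)"
  define \<kappa> where "\<kappa> = (- ln p / 2) / ((1 / q + 1 / p) + 1 / (2 * p))"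
  have \<kappa>0: "0 < \<kappa>" unfolding \<kappa>_def using p_pos q_pos ln_p_neg by (intro divide_pos_pos add_pos_pos) simp_all
  \<comment> \<open>The quadratic error for \<open>\<epsilon> = \<plusminus> \<kappa> / J\<close> together with the term \<open>1 / J\<^sup>2\<close> that feeds the harmonic series is \<open>K / J\<^sup>2\<close>.\<close>
  define K where "K = 2 * (1 / q\<^sup>2 + 1 / p\<^sup>2) * \<kappa>\<^sup>2 + 1"
  have psi: "?\<psi> (1 / 2 ^ 2 ^ J) = exp (2 ^ J * (ln p - w J))" for J
  proof -
    have "ln (1 / 2 ^ 2 ^ J :: real) = - (2 ^ J * ln 2)"
      by (simp add: ln_div ln_realpow)
    moreover have "ln (2 ^ J * ln 2 :: real) = real J * ln 2 + ln (ln 2)"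
      by (subst ln_mult_pos) (auto simp: ln_realpow)
    ultimately have "?\<psi> (1 / 2 ^ 2 ^ J) = exp (2 ^ J * ln p) * exp (- (2 ^ J * w J))"
      using two_powr_s[of "2 ^ J"] by (simp add: w_def)
    then show ?thesis by (simp add: exp_add[symmetric] algebra_simps)
  qed
  have "\<forall>\<^sub>F J in sequentially. 2 * K / (real J)\<^sup>2 \<le> w J \<and> 2 / (real J)\<^sup>2 \<le> w J \<and>
      real J \<le> 2 ^ J / (real J)\<^sup>2 \<and> \<kappa> / real J \<le> p / 2 \<and> \<kappa> / real J \<le> q / 2 \<and> 0 < J"
    unfolding w_def
  proof (intro eventually_conj gauge_exponent_dominates \<theta>)
    show "\<forall>\<^sub>F J in sequentially. real J \<le> 2 ^ J / (real J)\<^sup>2" by real_asymp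
    show "\<forall>\<^sub>F J in sequentially. \<kappa> / real J \<le> p / 2" using p_pos by real_asymp
    show "\<forall>\<^sub>F J in sequentially. \<kappa> / real J \<le> q / 2" using q_pos by real_asymp
    show "\<forall>\<^sub>F J in sequentially. 0 < (J::nat)" by (rule eventually_gt_at_top)
  qed
  then obtain J0 where J0: "\<And>J. J \<ge> J0 \<Longrightarrow> 2 * K / (real J)\<^sup>2 \<le> w J" 
      "\<And>J. J \<ge> J0 \<Longrightarrow> 2 / (real J)\<^sup>2 \<le> w J"  "\<And>J. J \<ge> J0 \<Longrightarrow> real J \<le> 2 ^ J / (real J)\<^sup>2"
      "\<And>J. J \<ge> J0 \<Longrightarrow> \<kappa> / real J \<le> p / 2" "\<And>J. J \<ge> J0 \<Longrightarrow> \<kappa> / real J \<le> q / 2"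
    unfolding eventually_sequentially by blast
  define W where "W = (\<lambda>J. {A \<in> Pow {1..2 ^ J}. 
      exp (2 ^ J * (ln p - w J / 2)) \<le> weight (\<lambda>_. q - \<kappa> / real J) (2 ^ J) A + weight (\<lambda>_. q + \<kappa> / real J) (2 ^ J) A})"
  have "hausdorff_measure ?\<psi> Xi_G \<le> 0"
  proof (rule hausdorff_measure_leI[OF zero_less_one])
    fix \<epsilon> :: real assume \<epsilon>: "0 < \<epsilon>"
    have r: "0 \<le> q - \<kappa> / real J \<and> q - \<kappa> / real J \<le> 1" "0 \<le> q + \<kappa> / real J \<and> q + \<kappa> / real J \<le> 1" if "J \<ge> J0" for J
    proof -
      have "0 \<le> \<kappa> / real J" using \<kappa>0 by simp
      then show "0 \<le> q - \<kappa> / real J \<and> q - \<kappa> / real J \<le> 1" "0 \<le> q + \<kappa> / real J \<and> q + \<kappa> / real J \<le> 1"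
        using J0(4,5)[OF that] p_pos q_pos q_eq by linarith+
    qed
    have E: "hausdorff_content ?\<psi> \<epsilon> (\<Union>A\<in>W J. cylinder (2 ^ J) A) \<le> ennreal (2 * (1/2) ^ J)"
      if J: "J \<ge> J0" "1 / 2 ^ 2 ^ J \<le> \<epsilon>" for J
    proof -
      define v where "v = (\<lambda>A. weight (\<lambda>_. q - \<kappa> / real J) (2 ^ J) A + weight (\<lambda>_. q + \<kappa> / real J) (2 ^ J) A)"
      have v0: "0 \<le> v A" for A
        unfolding v_def using r[OF J(1)] by (intro add_nonneg_nonneg weight_nonneg) auto
      have c: "hausdorff_content ?\<psi> \<epsilon> (cylinder (2 ^ J) A) \<le> ennreal (v A * exp (- real J))" if "A \<in> W J" for A
      proof -
        have d: "diameter (cylinder (2 ^ J) A) = 1 / 2 ^ 2 ^ J" by (simp add: cylinder_def)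
        have "hausdorff_content ?\<psi> \<epsilon> (cylinder (2 ^ J) A) \<le> ennreal (?\<psi> (diameter (cylinder (2 ^ J) A)))"
          by (rule hausdorff_content_le_single[of ?\<psi>]) (use J(2) d in \<open>auto simp: cylinder_def\<close>)
        also have "\<dots> = ennreal (exp (2 ^ J * (ln p - w J / 2)) * exp (- (2 ^ J * (w J / 2))))"
          unfolding d psi exp_add[symmetric] by (simp add: algebra_simps)
        also have "\<dots> \<le> ennreal (v A * exp (- real J))"
        proof (intro ennreal_leI mult_mono)
          show "exp (2 ^ J * (ln p - w J / 2)) \<le> v A" using that by (simp add: W_def v_def)
          have "real J \<le> 2 ^ J * (1 / (real J)\<^sup>2)" using J0(3)[OF J(1)] by simp
          also have "\<dots> \<le> 2 ^ J * (w J / 2)" using J0(2)[OF J(1)] by (intro mult_left_mono) auto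
          finally show "exp (- (2 ^ J * (w J / 2))) \<le> exp (- real J)" by simp
        qed (use v0 in auto)
        finally show ?thesis .
      qed
      have "hausdorff_content ?\<psi> \<epsilon> (\<Union>A\<in>W J. cylinder (2 ^ J) A) \<le> (\<Sum>A\<in>W J. hausdorff_content ?\<psi> \<epsilon> (cylinder (2 ^ J) A))"
        by (rule hausdorff_content_finite_UN) (use \<epsilon> in \<open>auto simp: W_def\<close>)
      also have "\<dots> \<le> (\<Sum>A\<in>W J. ennreal (v A * exp (- real J)))" by (intro sum_mono c)
      also have "\<dots> = ennreal ((\<Sum>A\<in>W J. v A) * exp (- real J))"
        unfolding sum_distrib_right using v0 by (intro sum_ennreal) auto
      also have "\<dots> \<le> ennreal (2 * (1/2) ^ J)"
      proof (intro ennreal_leI mult_mono)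
        have "(\<Sum>A\<in>W J. v A) \<le> (\<Sum>A\<in>Pow {1..2 ^ J}. v A)"
          by (intro sum_mono2) (auto simp: W_def v0)
        also have "\<dots> \<le> 1 + 1"
          unfolding v_def sum.distrib using r[OF J(1)] by (intro add_mono sum_weight_le_1) auto
        finally show "(\<Sum>A\<in>W J. v A) \<le> 2" by simp
        have "2 \<le> exp (1::real)" using exp_ge_add_one_self[of 1] by simp
        then have "2 ^ J \<le> exp (1::real) ^ J" by (intro power_mono) auto
        then have "(2::real) ^ J \<le> exp (real J)" by (simp add: exp_of_nat_mult[symmetric])
        then show "exp (- real J) \<le> (1/2) ^ J" by (simp add: exp_minus power_one_over inverse_eq_divide frac_le)
      qed auto
      finally show ?thesis .
    qed
    have cover: "Xi_G \<subseteq> (\<Union>i. \<Union>A\<in>W (J1 + i). cylinder (2 ^ (J1 + i)) A)" if J1: "J1 > J0" for J1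
    proof
      fix x assume "x \<in> Xi_G"
      then obtain A where A: "admissible A" "x = point A" by (auto simp: Xi_G_eq)
      have "\<exists>J\<ge>J1 - 1. \<exists>\<epsilon>\<in>{\<kappa> / Suc J, - \<kappa> / Suc J}.
          exp (2 ^ Suc J * (ln p - w (Suc J) / 2)) \<le> weight (\<lambda>_. q - \<epsilon>) (2 ^ Suc J) A"
      proof (rule heavy_prefix_exists[OF A(1) \<kappa>_def])
        fix J assume "J1 - 1 \<le> J"
        then have J: "J0 \<le> Suc J" using J1 by simp
        show "\<kappa> / Suc J \<le> p / 2" "\<kappa> / Suc J \<le> q / 2" using J0(4,5)[OF J] by auto
        have "2 * (1 / q\<^sup>2 + 1 / p\<^sup>2) * (\<kappa> / Suc J)\<^sup>2 + 1 / (real (Suc J))\<^sup>2 = K / (real (Suc J))\<^sup>2"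
          by (simp add: K_def power_divide add_divide_distrib del: of_nat_Suc)
        also have "\<dots> \<le> w (Suc J) / 2" using J0(1)[OF J] by (simp add: mult.commute)
        finally show "2 * (1 / q\<^sup>2 + 1 / p\<^sup>2) * (\<kappa> / Suc J)\<^sup>2 + 1 / (real (Suc J))\<^sup>2 \<le> w (Suc J) / 2" .
      qed
      then obtain J \<epsilon>' where J: "J1 - 1 \<le> J" and \<epsilon>': "\<epsilon>' \<in> {\<kappa> / Suc J, - \<kappa> / Suc J}"
        and le: "exp (2 ^ Suc J * (ln p - w (Suc J) / 2)) \<le> weight (\<lambda>_. q - \<epsilon>') (2 ^ Suc J) A" by blast
      have "J0 \<le> Suc J" using J J1 by simp
      note r' = r[OF this]
      have "0 \<le> weight (\<lambda>_. q - \<kappa> / real (Suc J)) (2 ^ Suc J) A" "0 \<le> weight (\<lambda>_. q + \<kappa> / real (Suc J)) (2 ^ Suc J) A"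
        using r' by (auto intro!: weight_nonneg simp del: of_nat_Suc power_Suc)
      with le \<epsilon>' have "A \<inter> {1..2 ^ Suc J} \<in> W (Suc J)"
        unfolding W_def by (auto simp: weight_restrict[unfolded One_nat_def] simp del: of_nat_Suc power_Suc)
      moreover have "x \<in> cylinder (2 ^ Suc J) (A \<inter> {1..2 ^ Suc J})"
        unfolding cylinder_restrict A(2) by (rule point_in_cylinder)
      moreover have "\<exists>i. Suc J = J1 + i" using J by (intro le_Suc_ex) simp
      then obtain i where "Suc J = J1 + i" ..
      ultimately show "x \<in> (\<Union>i. \<Union>A\<in>W (J1 + i). cylinder (2 ^ (J1 + i)) A)" by auto
    qed
    have "hausdorff_content ?\<psi> \<epsilon> Xi_G \<le> 0 + ennreal e" if e: "0 < e" for e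
    proof -
      have "\<forall>\<^sub>F J in sequentially. J > J0 \<and> 4 * (1/2) ^ J \<le> e \<and> (1 / 2) ^ J \<le> \<epsilon>"
      proof (intro eventually_conj)
        show "\<forall>\<^sub>F J in sequentially. 4 * (1/2) ^ J \<le> e" using e by real_asymp
        show "\<forall>\<^sub>F J in sequentially. (1/2) ^ J \<le> \<epsilon>" using \<epsilon> by real_asymp
      qed (rule eventually_gt_at_top)
      then obtain J1 where J1: "J1 > J0" "4 * (1/2) ^ J1 \<le> e" "(1/2) ^ J1 \<le> \<epsilon>"
        unfolding eventually_sequentially by blast
      have "hausdorff_content ?\<psi> \<epsilon> Xi_G \<le> (\<Sum>i. hausdorff_content ?\<psi> \<epsilon> (\<Union>A\<in>W (J1 + i). cylinder (2 ^ (J1 + i)) A))"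
        by (rule order_trans[OF hausdorff_content_mono[OF cover[OF J1(1)]] hausdorff_content_UN])
      also have "\<dots> \<le> (\<Sum>i. ennreal (2 * (1/2) ^ (J1 + i)))"
      proof (intro suminf_le E summableI)
        fix i
        show "J0 \<le> J1 + i" using J1 by simp
        have "(1 / 2 :: real) ^ 2 ^ (J1 + i) \<le> (1/2) ^ J1"
        proof (rule power_decreasing)
          have "J1 + i < 2 ^ (J1 + i)" by (rule less_exp)
          then show "J1 \<le> 2 ^ (J1 + i)" by linarith
        qed auto
        then show "1 / 2 ^ 2 ^ (J1 + i) \<le> \<epsilon>" using J1(3) by (simp add: power_one_over)
      qed
      also have "\<dots> = ennreal (4 * (1/2) ^ J1)"
      proof (rule suminf_ennreal_eq)
        show "(\<lambda>i. 2 * (1/2) ^ (J1 + i)) sums (4 * (1/2) ^ J1 :: real)"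
          using sums_mult[OF geometric_sums[of "1/2 :: real"], of "2 * (1/2) ^ J1"] by (simp add: power_add mult_ac)
      qed simp
      also have "\<dots> \<le> 0 + ennreal e" using J1(2) by (simp add: ennreal_leI)
      finally show ?thesis .
    qed
    then show "hausdorff_content ?\<psi> \<epsilon> Xi_G \<le> 0" by (rule ennreal_le_epsilon)
  qed
  then show ?thesis by simp
qed

end

section \<open>A Markov measure with slowly increasing density of ones\<close>

text \<open>Summation by parts: a sequence with bounded partial sums sees only the total variation of the
  weights.\<close>

lemma abs_sum_antimono_weights_le:
  fixes a d :: "nat \<Rightarrow> real"
  assumes S: "\<And>n. \<bar>\<Sum>k=1..n. a k\<bar> \<le> B"
    and d: "\<And>k. 1 \<le> k \<Longrightarrow> d (Suc k) \<le> d k" "\<And>k. 1 \<le> k \<Longrightarrow> 0 \<le> d k"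
  shows "\<bar>\<Sum>k=1..n. a k * d k\<bar> \<le> B * d 1"
proof -
  define T where "T = (\<lambda>n. \<Sum>k=1..n. a k)"
  have abel: "(\<Sum>k=1..n. a k * d k) = (\<Sum>k=1..n. T k * (d k - d (Suc k))) + T n * d (Suc n)"
    by (induction n) (auto simp: T_def algebra_simps)
  have tele: "(\<Sum>k=1..n. d k - d (Suc k)) = d 1 - d (Suc n)"
    by (induction n) auto
  have "\<bar>\<Sum>k=1..n. a k * d k\<bar> \<le> \<bar>\<Sum>k=1..n. T k * (d k - d (Suc k))\<bar> + \<bar>T n * d (Suc n)\<bar>"
    unfolding abel by (rule abs_triangle_ineq)
  also have "\<dots> \<le> (\<Sum>k=1..n. B * (d k - d (Suc k))) + B * d (Suc n)"
  proof (intro add_mono order_trans[OF sum_abs] sum_mono)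
    show "\<bar>T k * (d k - d (Suc k))\<bar> \<le> B * (d k - d (Suc k))" if "k \<in> {1..n}" for k
      unfolding abs_mult T_def using that d(1)[of k] by (intro mult_mono S) (auto intro: order_trans[OF abs_ge_zero S])
    show "\<bar>T n * d (Suc n)\<bar> \<le> B * d (Suc n)"
      unfolding abs_mult T_def using d(2)[of "Suc n"] by (intro mult_mono S) (auto intro: order_trans[OF abs_ge_zero S])
  qed
  also have "\<dots> = B * d 1" unfolding sum_distrib_left[symmetric] tele by (simp add: algebra_simps)
  finally show ?thesis .
qed

definition scale :: "nat \<Rightarrow> real" where "scale n = real n / (ln (4 * real n))\<^sup>2"

context golden begin

text \<open>The probability that digit \<open>k\<close> is a one under the stationary measure. It depends on
  the exponent of two in \<open>k\<close>.\<close>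

fun mean :: "nat \<Rightarrow> real" where
  "mean k = (if k = 0 then 0 else if even k then q * (1 - mean (k div 2)) else q)"

declare mean.simps[simp del]

lemma mean_rec: "1 \<le> k \<Longrightarrow> mean k = q * (1 - parent mean k)"
  by (subst mean.simps) (simp add: parent_def)

lemma mean_bounds: "0 \<le> mean k" "mean k \<le> q"
proof (induction k rule: less_induct)
  case (less k)
  have "0 \<le> mean k \<and> mean k \<le> q"
  proof (cases "k = 0")
    case True
    then show ?thesis using q_pos by (simp add: mean.simps)
  next
    case False
    have "0 \<le> parent mean k" "parent mean k \<le> 1"
      using less[of "k div 2"] False q_less_1 by (auto simp: parent_def)
    then show ?thesis
      using False q_pos mean_rec[of k] by (auto simp: mult_le_cancel_left1)
  qed
  then show "0 \<le> mean k" "mean k \<le> q" by auto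
qed

lemma sum_mean_rec: "(\<Sum>k=1..n. mean k) = q * n - q * (\<Sum>k=1..n div 2. mean k)"
proof -
  have "(\<Sum>k=1..n. mean k) = (\<Sum>k=1..n. q * (1 - parent mean k))"
    by (rule sum.cong) (auto simp: mean_rec)
  also have "\<dots> = q * n - q * (\<Sum>k=1..n div 2. mean k)"
    by (simp add: sum_distrib_left[symmetric] sum_subtractf sum_parent[unfolded One_nat_def] algebra_simps)
  finally show ?thesis .
qed

text \<open>The recursion between \<open>n\<close> and \<open>n div 2\<close> contracts the error by \<open>q\<close>, and each step adds a
  rounding error of at most \<open>q\<close>; the bound \<open>q / p\<close> is the geometric series.\<close>

lemma sum_mean_minus_density: "\<bar>\<Sum>k=1..n. mean k - density\<bar> \<le> q / p"
proof (induction n rule: less_induct)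
  case (less n)
  have eq: "(\<Sum>k=1..m. mean k - density) = (\<Sum>k=1..m. mean k) - density * m" for m :: nat
    by (simp add: sum_subtractf)
  show ?case
  proof (cases "n = 0")
    case True
    then show ?thesis using p_pos q_pos by simp
  next
    case False
    define e where "e = real n / 2 - real (n div 2)"
    have e: "0 \<le> e" "e \<le> 1 / 2" unfolding e_def by linarith+
    have D: "density * (2 + q) = 2 * q" using q_pos by (simp add: density_def)
    define r where "r = (\<Sum>k=1..n div 2. mean k - density)"
    have r: "\<bar>r\<bar> \<le> q / p" unfolding r_def using False by (intro less) auto
    have n: "real n = 2 * (e + real (n div 2))" by (simp add: e_def)
    have "(\<Sum>k=1..n. mean k - density) = q * n - q * (r + density * (n div 2)) - density * n"
      unfolding eq sum_mean_rec[of n] r_def by simp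
    also have "\<dots> = n / 2 * (2 * q - density * (2 + q)) + q * density * e - q * r"
      unfolding e_def by (simp add: algebra_simps)
    also have "\<dots> = q * (density * e - r)" unfolding D by (simp add: algebra_simps)
    finally have *: "\<bar>\<Sum>k=1..n. mean k - density\<bar> = q * \<bar>density * e - r\<bar>" using q_pos by (simp add: abs_mult)
    have "density * e \<le> 1 * 1" using density_bounds e by (intro mult_mono) auto
    moreover have "0 \<le> density * e" using density_bounds e by simp
    ultimately have "\<bar>density * e - r\<bar> \<le> 1 + q / p" using r by linarith
    also have "\<dots> = 1 / p" using p_pos q_eq by (simp add: field_simps)
    finally show ?thesis unfolding * using q_pos by (simp add: divide_inverse mult_left_mono)
  qed
qed

end

text \<open>The means of the digits are prescribed, as \<open>mean k * (1 - drift k)\<close>, and the transition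
  probabilities \<open>rate\<close> are computed from them. In this way the number of ones has an
  explicit expectation, and only bounds are needed for the transition probabilities.\<close>

locale golden_drift = golden +
  fixes \<delta> :: real
  assumes \<delta>_pos: "0 < \<delta>" and \<delta>_le_1: "\<delta> \<le> 1"
begin

definition drift where "drift k = \<delta> / ln (4 * real k)"

definition drifted_mean where "drifted_mean k = mean k * (1 - drift k)"

definition rate where "rate k = drifted_mean k / (1 - parent drifted_mean k)"

lemma ln_4_times: "1 \<le> k \<Longrightarrow> 4 / 3 \<le> ln (4 * real k)"
proof -
  assume "1 \<le> k"
  then have "ln 4 \<le> ln (4 * real k)" by simp
  moreover have "ln (4::real) = 2 * ln 2" using ln_realpow[of 2 2] by simp
  ultimately show ?thesis using ln2_ge_two_thirds by simp
qed

lemma drift_bounds: assumes "1 \<le> k" shows "0 \<le> drift k" "drift k \<le> 3 / 4 * \<delta>"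
proof -
  show "0 \<le> drift k" using ln_4_times[OF assms] \<delta>_pos by (simp add: drift_def)
  have "\<delta> / ln (4 * real k) \<le> \<delta> / (4 / 3)"
    using ln_4_times[OF assms] \<delta>_pos by (intro divide_left_mono) auto
  then show "drift k \<le> 3 / 4 * \<delta>" by (simp add: drift_def)
qed

lemma drift_antimono: assumes "1 \<le> j" "j \<le> k" shows "drift k \<le> drift j"
  unfolding drift_def
  using assms ln_4_times[of j] ln_4_times[of k] \<delta>_pos by (intro divide_left_mono) auto

lemma drifted_mean_bounds: "0 \<le> drifted_mean k" "drifted_mean k \<le> q"
proof -
  have "0 \<le> drifted_mean k \<and> drifted_mean k \<le> q"
  proof (cases "k = 0")
    case True
    then show ?thesis using q_pos by (simp add: drifted_mean_def mean.simps)
  next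
    case False
    then have "0 \<le> 1 - drift k" "1 - drift k \<le> 1" using drift_bounds[of k] \<delta>_le_1 by auto
    then show ?thesis
      using mean_bounds[of k] mult_mono[of "mean k" q "1 - drift k" 1] by (auto simp: drifted_mean_def)
  qed
  then show "0 \<le> drifted_mean k" "drifted_mean k \<le> q" by auto
qed

lemma parent_drifted_mean: "0 \<le> parent drifted_mean k" "parent drifted_mean k \<le> q"
  using drifted_mean_bounds[of "k div 2"] q_pos by (auto simp: parent_def)

lemma drifted_mean_rec: "drifted_mean k = rate k * (1 - parent drifted_mean k)"
  using parent_drifted_mean[of k] q_less_1 by (simp add: rate_def)

text \<open>Both the digit and its parent have means lowered by a factor at least \<open>1 - \<delta> / ln (2 k)\<close>; the
  denominator of \<open>rate\<close> is at least \<open>p\<close>.\<close>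

lemma rate_bounds:
  assumes k: "1 \<le> k"
  shows "0 \<le> rate k" "rate k \<le> q" "q - rate k \<le> q / p * (\<delta> / ln (2 * real k))"
proof -
  define m where "m = parent mean k"
  define d where "d = drift k"
  define u where "u = (if even k then mean (k div 2) * drift (k div 2) else 0)"
  define D where "D = \<delta> / ln (2 * real k)"
  have pd: "parent drifted_mean k = m - u"
    by (simp add: parent_def m_def u_def drifted_mean_def algebra_simps)
  have m: "0 \<le> m" "m \<le> q" using mean_bounds[of "k div 2"] q_pos by (auto simp: m_def parent_def)
  have L: "0 < ln (2 * real k)" using k by simp
  have d: "0 \<le> d" "d \<le> D" "d \<le> 1"
  proof -
    show "0 \<le> d" "d \<le> 1" using drift_bounds[OF k] \<delta>_le_1 by (auto simp: d_def)
    have "ln (2 * real k) \<le> ln (4 * real k)" using k by simp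
    then show "d \<le> D" unfolding d_def drift_def D_def using L \<delta>_pos by (intro divide_left_mono) auto
  qed
  have u: "0 \<le> u" "u \<le> m * D"
  proof -
    have "u = m * (if even k then drift (k div 2) else 0)" by (simp add: u_def m_def parent_def)
    moreover have "(if even k then drift (k div 2) else 0) \<le> D"
    proof (cases "even k")
      case True
      then have "4 * real (k div 2) = 2 * real k" by (auto elim!: evenE)
      then have "drift (k div 2) = D" by (simp only: drift_def D_def)
      then show ?thesis using True by simp
    qed (use d in simp)
    moreover have "0 \<le> (if even k then drift (k div 2) else 0)"
      using drift_bounds(1)[of "k div 2"] k by auto
    ultimately show "0 \<le> u" "u \<le> m * D" using m by (auto intro: mult_left_mono)
  qed
  have den: "p \<le> 1 - m" "p \<le> 1 - m + u" using m u q_eq by auto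
  have rate: "rate k = q * ((1 - m) * (1 - d)) / (1 - m + u)"
    unfolding rate_def drifted_mean_def pd mean_rec[OF k] m_def[symmetric] d_def[symmetric] by (simp add: algebra_simps)
  have num: "0 \<le> u + (1 - m) * d" "u + (1 - m) * d \<le> D"
  proof -
    show "0 \<le> u + (1 - m) * d" using u d den p_pos by auto
    have "(1 - m) * d \<le> (1 - m) * D" using d den p_pos by (intro mult_left_mono) auto
    then show "u + (1 - m) * d \<le> D" using u by (simp add: algebra_simps)
  qed
  have diff: "q - rate k = q * ((u + (1 - m) * d) / (1 - m + u))"
    unfolding rate using den p_pos by (simp add: field_simps)
  show "0 \<le> rate k" unfolding rate using den p_pos d q_pos by (intro divide_nonneg_pos mult_nonneg_nonneg) auto
  have "0 \<le> q * ((u + (1 - m) * d) / (1 - m + u))"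
    using num den p_pos q_pos by (intro mult_nonneg_nonneg divide_nonneg_pos) auto
  then show "rate k \<le> q" using diff by simp
  have "(u + (1 - m) * d) / (1 - m + u) \<le> D / p"
    using num den p_pos by (intro frac_le) auto
  then have "q - rate k \<le> q * (D / p)" unfolding diff using q_pos by (intro mult_left_mono) auto
  then show "q - rate k \<le> q / p * (\<delta> / ln (2 * real k))" by (simp add: D_def mult.commute)
qed

lemma rate_unit: "1 \<le> k \<Longrightarrow> 0 \<le> rate k \<and> rate k \<le> 1"
  using rate_bounds[of k] q_less_1 by auto

text \<open>The expectation of the exponent \<open>N n / 2 - N (n div 2)\<close>.\<close>

definition mean_drop where
  "mean_drop n = (\<Sum>k=1..n. drifted_mean k) / 2 - (\<Sum>k=1..n div 2. drifted_mean k)"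

lemma drift_step: assumes "1 \<le> k" "2 * k \<le> n"
  shows "\<delta> * ln 2 / (2 * (ln (4 * real n))\<^sup>2) \<le> drift k - (drift (2 * k - 1) + drift (2 * k)) / 2"
proof -
  have n: "1 \<le> n" using assms by simp
  define L where "L = ln (4 * real n)"
  have k4: "0 < ln (4 * real k)" "ln (4 * real k) \<le> L"
    using assms ln_4_times[of k] by (auto simp: L_def)
  have k8: "ln (4 * real (2 * k)) = ln (4 * real k) + ln 2" "ln (4 * real (2 * k)) \<le> L"
  proof -
    have "ln (4 * real k * 2) = ln (4 * real k) + ln 2" using assms by (intro ln_mult_pos) auto
    then show "ln (4 * real (2 * k)) = ln (4 * real k) + ln 2" by (simp add: mult_ac)
    have "real (2 * k) \<le> real n" using assms(2) by (rule of_nat_mono)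
    then show "ln (4 * real (2 * k)) \<le> L" using assms by (simp add: L_def)
  qed
  have "\<delta> * ln 2 / L\<^sup>2 \<le> \<delta> * ln 2 / (ln (4 * real k) * ln (4 * real (2 * k)))"
  proof (intro divide_left_mono)
    show "ln (4 * real k) * ln (4 * real (2 * k)) \<le> L\<^sup>2"
      unfolding power2_eq_square using k4 k8 by (intro mult_mono) auto
    show "0 \<le> \<delta> * ln 2" using \<delta>_pos by simp
    show "0 < L\<^sup>2 * (ln (4 * real k) * ln (4 * real (2 * k)))"
      using k4 k8 by (intro mult_pos_pos zero_less_power) (auto intro: add_pos_pos)
  qed
  also have "\<dots> = drift k - drift (2 * k)"
  proof -
    have "0 < ln (4 * real k) + ln 2" using k4 by (simp add: add_pos_pos)
    then show ?thesis unfolding drift_def k8(1) using k4 by (simp add: field_simps)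
  qed
  finally have "\<delta> * ln 2 / L\<^sup>2 \<le> drift k - drift (2 * k)" .
  moreover have "drift (2 * k - 1) \<le> drift k" using assms by (intro drift_antimono) auto
  ultimately show ?thesis unfolding L_def[symmetric] by (simp add: field_simps)
qed

text \<open>The terms \<open>2k - 1\<close> and \<open>2k\<close> of the sum up to \<open>n\<close> are compared with the term \<open>k\<close> of the sum up
  to \<open>n div 2\<close>. An odd \<open>n\<close> leaves one unpaired term, which costs \<open>\<delta> / 2\<close>.\<close>

lemma sum_drift_gap:
  "real (n div 2) * (\<delta> * ln 2 / (2 * (ln (4 * real n))\<^sup>2)) - \<delta> / 2
     \<le> (\<Sum>k=1..n div 2. drift k) - (\<Sum>k=1..n. drift k) / 2"
proof -
  define h where "h = n div 2"
  have pair: "(\<Sum>k=1..2 * j. drift k) = (\<Sum>k=1..j. drift (2 * k - 1) + drift (2 * k))" for j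
    by (induction j) auto
  have "(\<Sum>k=1..n. drift k) \<le> (\<Sum>k=1..2 * h. drift k) + \<delta>"
  proof (cases "even n")
    case True
    then show ?thesis using \<delta>_pos by (simp add: h_def)
  next
    case False
    then have n: "n = Suc (2 * h)" by (simp add: h_def)
    have "drift n \<le> \<delta>" using drift_bounds[of n] n \<delta>_pos by simp
    then show ?thesis unfolding n by simp
  qed
  moreover have "real h * (\<delta> * ln 2 / (2 * (ln (4 * real n))\<^sup>2)) \<le>
      (\<Sum>k=1..h. drift k - (drift (2 * k - 1) + drift (2 * k)) / 2)"
    using sum_bounded_below[of "{1..h}" "\<delta> * ln 2 / (2 * (ln (4 * real n))\<^sup>2)"
        "\<lambda>k. drift k - (drift (2 * k - 1) + drift (2 * k)) / 2"] drift_step[of _ n]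
    by (force simp: h_def)
  moreover have "(\<Sum>k=1..h. drift k - (drift (2 * k - 1) + drift (2 * k)) / 2)
      = (\<Sum>k=1..h. drift k) - (\<Sum>k=1..2 * h. drift k) / 2"
    unfolding pair sum_subtractf sum_divide_distrib[symmetric] ..
  ultimately show ?thesis unfolding h_def[symmetric] by linarith
qed

text \<open>By summation by parts each \<open>mean k\<close> may be replaced by \<open>density\<close> at bounded cost; the
  main part then reduces to the sums of \<open>drift\<close>.\<close>

lemma mean_drop_lower:
  "density * (real (n div 2) * (\<delta> * ln 2 / (2 * (ln (4 * real n))\<^sup>2)) - \<delta> / 2) - 3 * (q / p) \<le> mean_drop n"
proof -
  define S where "S = (\<lambda>n. \<Sum>k=1..n. mean k - density)"
  define R where "R = (\<lambda>n. \<Sum>k=1..n. (mean k - density) * drift k)"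
  define \<Delta> where "\<Delta> = (\<lambda>n. \<Sum>k=1..n. drift k)"
  have S: "\<bar>S m\<bar> \<le> q / p" for m unfolding S_def by (rule sum_mean_minus_density)
  have R: "\<bar>R m\<bar> \<le> q / p" for m
  proof -
    have "\<bar>R m\<bar> \<le> q / p * drift 1"
      unfolding R_def by (rule abs_sum_antimono_weights_le)
        (auto intro: sum_mean_minus_density[unfolded One_nat_def] drift_antimono drift_bounds)
    also have "\<dots> \<le> q / p * 1"
      using drift_bounds[of 1] \<delta>_le_1 \<delta>_pos p_pos q_pos by (intro mult_left_mono) auto
    finally show ?thesis by simp
  qed
  have sum: "(\<Sum>k=1..m. drifted_mean k) = S m + density * m - (R m + density * \<Delta> m)" for m
  proof -
    have "(\<Sum>k=1..m. drifted_mean k) = (\<Sum>k=1..m. (mean k - density) + density - ((mean k - density) * drift k + density * drift k))"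
      by (rule sum.cong) (auto simp: drifted_mean_def algebra_simps)
    also have "\<dots> = S m + density * m - (R m + density * \<Delta> m)"
      by (simp add: S_def R_def \<Delta>_def sum_subtractf sum.distrib sum_distrib_left)
    finally show ?thesis .
  qed
  define h where "h = n div 2"
  have "mean_drop n = S n / 2 - S h - (R n / 2 - R h) + density * (n / 2 - h) + density * (\<Delta> h - \<Delta> n / 2)"
    unfolding mean_drop_def sum h_def[symmetric] by (simp add: field_simps)
  moreover have "0 \<le> density * (n / 2 - h)"
    using density_bounds by (intro mult_nonneg_nonneg) (auto simp: h_def)
  moreover have "density * (real (n div 2) * (\<delta> * ln 2 / (2 * (ln (4 * real n))\<^sup>2)) - \<delta> / 2) \<le> density * (\<Delta> h - \<Delta> n / 2)"
    unfolding \<Delta>_def h_def using density_bounds by (intro mult_left_mono sum_drift_gap) auto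
  ultimately show ?thesis using S[of n] S[of h] R[of n] R[of h] by linarith
qed

lemma mean_drop_eventually:
  "\<forall>\<^sub>F n in sequentially. density * \<delta> * ln 2 / 8 * scale n \<le> mean_drop n"
proof -
  define a where "a = density * \<delta>"
  have a: "0 < a" using density_bounds \<delta>_pos by (simp add: a_def)
  define b where "b = a / 2 + 3 * (q / p)"
  have "\<forall>\<^sub>F n in sequentially. a * ln 2 / 8 * (real n / (ln (4 * real n))\<^sup>2) \<le>
     ((real n - 1) / 2) * (a * ln 2 / (2 * (ln (4 * real n))\<^sup>2)) - b"
    using a by real_asymp
  then show ?thesis
  proof eventually_elim
    case (elim n)
    have "n \<le> 2 * (n div 2) + 1" by simp
    then have "real n \<le> real (2 * (n div 2) + 1)" by (rule of_nat_mono)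
    then have "real n \<le> 2 * real (n div 2) + 1" by (simp only: of_nat_add of_nat_mult of_nat_numeral of_nat_1)
    moreover have "(x - 1) / 2 \<le> y" if "x \<le> 2 * y + 1" for x y :: real using that by simp
    ultimately have "(real n - 1) / 2 \<le> real (n div 2)" by blast
    then have "((real n - 1) / 2) * (a * ln 2 / (2 * (ln (4 * real n))\<^sup>2)) \<le> real (n div 2) * (a * ln 2 / (2 * (ln (4 * real n))\<^sup>2))"
      using a by (intro mult_right_mono) auto
    then show ?case using elim mean_drop_lower[of n]
      by (simp add: a_def b_def scale_def algebra_simps)
  qed
qed

end

section \<open>Concentration of the prefix masses\<close>

lemma exp_le_quadratic:
  fixes u :: real
  assumes "\<bar>u\<bar> \<le> 1"
  shows "exp u \<le> 1 + u + u\<^sup>2"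
proof (cases "0 \<le> u")
  case True
  then show ?thesis using assms exp_bound[of u] by simp
next
  case False
  define v where "v = - u"
  have v: "0 \<le> v" using False by (simp add: v_def)
  have "1 \<le> 1 + v\<^sup>2 / 2 + v ^ 3 / 2 + v ^ 4 / 2" using v by simp
  also have "\<dots> = (1 + v + v\<^sup>2 / 2) * (1 - v + v\<^sup>2)"
    by (simp add: algebra_simps power2_eq_square power3_eq_cube power4_eq_xxxx add_divide_distrib diff_divide_distrib)
  also have "\<dots> \<le> exp v * (1 - v + v\<^sup>2)"
  proof (rule mult_right_mono)
    show "1 + v + v\<^sup>2 / 2 \<le> exp v" by (rule exp_lower_Taylor_quadratic[OF v])
    have "0 \<le> (v - 1 / 2)\<^sup>2" by simp
    then show "0 \<le> 1 - v + v\<^sup>2" by (simp add: power2_eq_square algebra_simps)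
  qed
  finally have "exp (- v) \<le> 1 - v + v\<^sup>2" by (simp add: exp_minus field_simps)
  then show ?thesis by (simp add: v_def)
qed

lemma exp_centered_bernoulli:
  fixes r z :: real
  assumes "0 \<le> r" "r \<le> 1" "\<bar>z\<bar> \<le> 1"
  shows "(1 - r) * exp (z * r) + r * exp (- (z * (1 - r))) \<le> exp (z\<^sup>2)"
proof -
  have "\<bar>z * r\<bar> \<le> 1" "\<bar>- (z * (1 - r))\<bar> \<le> 1"
    using mult_le_one[of "\<bar>z\<bar>" "\<bar>r\<bar>"] mult_le_one[of "\<bar>z\<bar>" "\<bar>1 - r\<bar>"] assms by (auto simp: abs_mult)
  then have "(1 - r) * exp (z * r) + r * exp (- (z * (1 - r)))
      \<le> (1 - r) * (1 + z * r + (z * r)\<^sup>2) + r * (1 + (- (z * (1 - r))) + (- (z * (1 - r)))\<^sup>2)"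
    using assms by (intro add_mono mult_left_mono exp_le_quadratic) auto
  also have "\<dots> = 1 + z\<^sup>2 * (r * (1 - r))"
    by (simp add: algebra_simps power2_eq_square)
  also have "\<dots> \<le> 1 + z\<^sup>2 * 1"
    using assms by (intro add_left_mono mult_left_mono mult_le_one) auto
  also have "\<dots> \<le> exp (z\<^sup>2)" by simp
  finally show ?thesis .
qed

lemma markov_sum:
  fixes w f :: "'a \<Rightarrow> real"
  assumes "finite S" "\<And>x. x \<in> S \<Longrightarrow> 0 \<le> w x" "\<And>x. x \<in> S \<Longrightarrow> 0 \<le> f x" "0 < c"
    and "(\<Sum>x\<in>S. w x * f x) \<le> M"
  shows "(\<Sum>x | x \<in> S \<and> c \<le> f x. w x) \<le> M / c"
proof -
  have "c * (\<Sum>x | x \<in> S \<and> c \<le> f x. w x) \<le> (\<Sum>x | x \<in> S \<and> c \<le> f x. w x * f x)"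
    unfolding sum_distrib_left using assms(2) by (intro sum_mono) (auto simp: mult.commute[of c] intro: mult_left_mono)
  also have "\<dots> \<le> (\<Sum>x\<in>S. w x * f x)"
    using assms(1-3) by (intro sum_mono2) auto
  also have "\<dots> \<le> M" by (rule assms(5))
  finally show ?thesis using assms(4) by (simp add: field_simps)
qed

lemma sum_up_to_half:
  fixes f :: "nat \<Rightarrow> real"
  shows "(\<Sum>k=1..n. if 2 * k \<le> n then f k else 0) = (\<Sum>k=1..n div 2. f k)"
proof -
  have "{1..n div 2} = {k \<in> {1..n}. 2 * k \<le> n}" by auto
  then show ?thesis by (simp only: sum.inter_filter[OF finite_atLeastAtMost])
qed

text \<open>Indices up to \<open>sqrt n\<close> are few; beyond them \<open>ln (2 k)\<close> is at least half of \<open>ln (4 n)\<close>.\<close>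

lemma sum_inverse_log_squared:
  "\<forall>\<^sub>F n in sequentially. (\<Sum>k=1..n. 1 / (ln (2 * real k))\<^sup>2) \<le> 5 * scale n"
proof -
  \<comment> \<open>The number \<open>9 / 4\<close> bounds \<open>1 / (ln 2)\<^sup>2\<close>.\<close>
  have "\<forall>\<^sub>F n in sequentially. sqrt (real n) * (9 / 4) + 4 * (real n / (ln (4 * real n))\<^sup>2) \<le> 5 * (real n / (ln (4 * real n))\<^sup>2)"
    by real_asymp
  moreover have "\<forall>\<^sub>F n in sequentially. 0 < (n::nat)" by (rule eventually_gt_at_top)
  ultimately show ?thesis
  proof eventually_elim
    case (elim n)
    define L where "L = ln (4 * real n)"
    have L: "0 < L" using elim by (simp add: L_def)
    have "(\<Sum>k=1..n. 1 / (ln (2 * real k))\<^sup>2) \<le> (\<Sum>k=1..n. (if k\<^sup>2 \<le> n then 9 / 4 else 0) + 4 / L\<^sup>2)"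
    proof (rule sum_mono)
      fix k assume k: "k \<in> {1..n}"
      have ln2: "ln 2 \<le> ln (2 * real k)" using k by simp
      show "1 / (ln (2 * real k))\<^sup>2 \<le> (if k\<^sup>2 \<le> n then 9 / 4 else 0) + 4 / L\<^sup>2"
      proof (cases "k\<^sup>2 \<le> n")
        case True
        have "(2 / 3)\<^sup>2 \<le> (ln (2 * real k))\<^sup>2" using ln2 ln2_ge_two_thirds by (intro power_mono) auto
        moreover have "0 < ln (2 * real k)" using k by simp
        ultimately have "1 / (ln (2 * real k))\<^sup>2 \<le> 1 / (2 / 3)\<^sup>2"
          by (intro divide_left_mono mult_pos_pos zero_less_power) auto
        also have "\<dots> = 9 / 4" by (simp add: power2_eq_square)
        also have "9 / 4 \<le> 9 / 4 + 4 / L\<^sup>2" by simp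
        finally show ?thesis using True by simp
      next
        case False
        then have "real n \<le> (real k)\<^sup>2" by (metis less_imp_le not_le of_nat_le_iff of_nat_power)
        then have "4 * real n \<le> (2 * real k)\<^sup>2" by (simp add: power_mult_distrib)
        then have "L \<le> ln ((2 * real k)\<^sup>2)" unfolding L_def using elim k by (subst ln_le_cancel_iff) auto
        also have "\<dots> = 2 * ln (2 * real k)" using k by (subst ln_realpow) auto
        finally have "L\<^sup>2 \<le> (2 * ln (2 * real k))\<^sup>2" using L by (intro power_mono) auto
        moreover have "0 < 2 * ln (2 * real k)" using k by simp
        ultimately have "1 / (2 * ln (2 * real k))\<^sup>2 \<le> 1 / L\<^sup>2"
          using L by (intro divide_left_mono mult_pos_pos zero_less_power) auto
        then show ?thesis using False by (simp add: power_mult_distrib)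
      qed
    qed
    also have "\<dots> = (\<Sum>k | k \<in> {1..n} \<and> k\<^sup>2 \<le> n. 9 / 4) + n * (4 / L\<^sup>2)"
      by (simp add: sum.distrib sum.inter_filter[symmetric])
    also have "(\<Sum>k | k \<in> {1..n} \<and> k\<^sup>2 \<le> n. 9 / 4) \<le> sqrt (real n) * (9 / 4 :: real)"
    proof -
      have "{k. k \<in> {1..n} \<and> k\<^sup>2 \<le> n} \<subseteq> {1..nat \<lfloor>sqrt (real n)\<rfloor>}"
      proof safe
        fix k assume "k \<in> {1..n}" "k\<^sup>2 \<le> n"
        then have "real k \<le> sqrt (real n)" by (metis of_nat_le_iff of_nat_power real_le_rsqrt)
        then show "k \<in> {1..nat \<lfloor>sqrt (real n)\<rfloor>}" using \<open>k \<in> {1..n}\<close> by (simp add: le_nat_floor)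
      qed
      then have "card {k. k \<in> {1..n} \<and> k\<^sup>2 \<le> n} \<le> nat \<lfloor>sqrt (real n)\<rfloor>"
        using card_mono[of "{1..nat \<lfloor>sqrt (real n)\<rfloor>}"] by simp
      then have "real (card {k. k \<in> {1..n} \<and> k\<^sup>2 \<le> n}) \<le> sqrt (real n)"
        by (simp add: le_nat_iff le_floor_iff)
      then show ?thesis by simp
    qed
    finally show ?case using elim by (simp add: scale_def L_def)
  qed
qed

definition excess :: "nat set \<Rightarrow> nat \<Rightarrow> real" where
  "excess A n = ones A n / 2 - ones A (n div 2)"

context golden_drift begin

text \<open>The coefficients that write \<open>excess A n\<close>, centred, as a sum of martingale differences. A one
  at \<open>k\<close> contributes to \<open>excess\<close> directly and also forces the digit \<open>2 k\<close> to be zero;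
  the recursion compensates for the latter.\<close>

function coef :: "nat \<Rightarrow> nat \<Rightarrow> real" where
  "coef n k = (if 0 < k \<and> 2 * k \<le> n then - 1 / 2 - rate (2 * k) * coef n (2 * k) else 1 / 2)"
  by auto
termination by (relation "Wellfounded.measure (\<lambda>(n, k). n - k)") auto

declare coef.simps[simp del]

lemma abs_coef_le: "\<bar>coef n k\<bar> \<le> 1 / (2 * p)"
proof (induction n k rule: coef.induct)
  case (1 n k)
  have p2: "1 / (2 * p) = 1 / 2 + q * (1 / (2 * p))" using p_pos q_eq by (simp add: field_simps)
  show ?case
  proof (cases "0 < k \<and> 2 * k \<le> n")
    case True
    have "\<bar>coef n k\<bar> \<le> 1 / 2 + rate (2 * k) * \<bar>coef n (2 * k)\<bar>"
      using True rate_bounds(1)[of "2 * k"] by (subst coef.simps) (auto simp: abs_mult intro: order_trans[OF abs_triangle_ineq4])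
    also have "\<dots> \<le> 1 / 2 + q * (1 / (2 * p))"
      using True rate_bounds[of "2 * k"] 1 q_pos by (intro add_left_mono mult_mono) auto
    finally show ?thesis using p2 by simp
  next
    case False
    then have "coef n k = 1 / 2" by (subst coef.simps) auto
    moreover have "1 / 2 \<le> 1 / (2 * p)" using p_pos p_less_1 by (simp add: field_simps)
    ultimately show ?thesis by simp
  qed
qed

lemma excess_martingale:
  "(\<Sum>k=1..n. coef n k * (of_bool (k \<in> A) - rate k * of_bool (free A k))) = excess A n - mean_drop n"
proof -
  define D where "D = (\<lambda>k. of_bool (k \<in> A) - drifted_mean k)"
  define g where "g = (\<lambda>k. rate (2 * k) * coef n (2 * k) * D k)"
  have "coef n k * (of_bool (k \<in> A) - rate k * of_bool (free A k)) = coef n k * D k + parent g k" for k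
  proof -
    have "of_bool (k \<in> A) - rate k * of_bool (free A k) = D k + rate k * parent D k"
      unfolding of_bool_free using drifted_mean_rec[of k]
      by (auto simp: D_def parent_def algebra_simps)
    moreover have "coef n k * (rate k * parent D k) = parent g k" by (auto simp: parent_def g_def)
    ultimately show ?thesis by (simp add: algebra_simps)
  qed
  then have "(\<Sum>k=1..n. coef n k * (of_bool (k \<in> A) - rate k * of_bool (free A k)))
      = (\<Sum>k=1..n. coef n k * D k) + (\<Sum>k=1..n div 2. g k)"
    by (simp only: sum.distrib sum_parent)
  also have "(\<Sum>k=1..n. coef n k * D k) = (\<Sum>k=1..n. D k / 2 - (if 2 * k \<le> n then D k + g k else 0))"
    by (rule sum.cong) (auto simp: coef.simps[of n] g_def algebra_simps)
  also have "\<dots> = (\<Sum>k=1..n. D k) / 2 - ((\<Sum>k=1..n div 2. D k) + (\<Sum>k=1..n div 2. g k))"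
    unfolding sum_subtractf sum_up_to_half sum.distrib sum_divide_distrib ..
  finally show ?thesis
    by (simp add: D_def sum_subtractf excess_def mean_drop_def ones_def diff_divide_distrib del: sum_of_bool_eq)
qed

text \<open>The exponential moment method. The martingale differences are bounded by \<open>1 / (2 p)\<close>, so the
  logarithm of the moment at \<open>t\<close> is at most \<open>n t\<^sup>2 / (4 p\<^sup>2)\<close>, and the choice of \<open>t\<close> minimises the
  bound.\<close>

lemma excess_lower_tail:
  assumes y: "0 < y" "y \<le> real n"
  shows "(\<Sum>A | A \<in> Pow {1..n} \<and> excess A n \<le> mean_drop n - y. weight rate n A) \<le> exp (- (p\<^sup>2 * y\<^sup>2 / n))"
proof -
  have n: "0 < real n" using y by linarith
  define t where "t = 2 * p\<^sup>2 * y / n"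
  have t: "0 < t" "t * (1 / (2 * p)) \<le> 1"
  proof -
    show "0 < t" using y n p_pos by (simp add: t_def)
    have "t * (1 / (2 * p)) = p * (y / n)" using p_pos by (simp add: t_def power2_eq_square)
    also have "\<dots> \<le> 1" using y n p_pos p_less_1 by (intro mult_le_one) auto
    finally show "t * (1 / (2 * p)) \<le> 1" .
  qed
  define F where "F = (\<lambda>k A. exp (- (t * coef n k * (of_bool (k \<in> A) - rate k * of_bool (free A k)))))"
  have "(\<Sum>A\<in>Pow {1..n}. weight rate n A * (\<Prod>k=1..n. F k A)) \<le> (\<Prod>k=1..n. exp ((t * coef n k)\<^sup>2))"
  proof (rule sum_weight_prod_le)
    fix k :: nat and A assume k: "1 \<le> k" and A: "free A k" "k \<notin> A"
    have "\<bar>t * coef n k\<bar> \<le> t * (1 / (2 * p))"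
      unfolding abs_mult using t abs_coef_le[of n k] by (intro mult_mono) auto
    then have "\<bar>t * coef n k\<bar> \<le> 1" using t by simp
    then show "(1 - rate k) * F k A + rate k * F k (insert k A) \<le> exp ((t * coef n k)\<^sup>2)"
      using exp_centered_bernoulli[of "rate k" "t * coef n k"] rate_unit[OF k] A k
      by (simp add: F_def free_insert)
  next
    fix k :: nat and A B :: "nat set" assume "A \<inter> {..k} = B \<inter> {..k}"
    from free_cong[OF this] mem_cong[OF this] show "F k A = F k B" by (simp add: F_def)
  qed (auto simp: rate_unit F_def)
  also have "\<dots> \<le> (\<Prod>k=1..n. exp ((t * (1 / (2 * p)))\<^sup>2))"
  proof (intro prod_mono conjI)
    fix k
    have "\<bar>t * coef n k\<bar> \<le> \<bar>t * (1 / (2 * p))\<bar>"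
      unfolding abs_mult using t abs_coef_le[of n k] p_pos by (intro mult_left_mono) auto
    then show "exp ((t * coef n k)\<^sup>2) \<le> exp ((t * (1 / (2 * p)))\<^sup>2)" by (simp only: abs_le_square_iff exp_le_cancel_iff)
  qed auto
  also have "\<dots> = exp (n * (t * (1 / (2 * p)))\<^sup>2)" by (simp add: exp_of_nat_mult)
  finally have mgf: "(\<Sum>A\<in>Pow {1..n}. weight rate n A * (\<Prod>k=1..n. F k A)) \<le> exp (n * (t * (1 / (2 * p)))\<^sup>2)" .
  have prodF: "(\<Prod>k=1..n. F k A) = exp (t * (mean_drop n - excess A n))" for A
  proof -
    have "(\<Prod>k=1..n. F k A) = exp (\<Sum>k=1..n. - (t * coef n k * (of_bool (k \<in> A) - rate k * of_bool (free A k))))"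
      by (simp add: F_def exp_sum)
    also have "(\<Sum>k=1..n. - (t * coef n k * (of_bool (k \<in> A) - rate k * of_bool (free A k))))
        = - (t * (excess A n - mean_drop n))"
      unfolding excess_martingale[symmetric] sum_distrib_left sum_negf by (simp only: mult.assoc)
    finally show ?thesis by (simp add: algebra_simps)
  qed
  have "(\<Sum>A | A \<in> Pow {1..n} \<and> excess A n \<le> mean_drop n - y. weight rate n A)
      = (\<Sum>A | A \<in> Pow {1..n} \<and> exp (t * y) \<le> (\<Prod>k=1..n. F k A). weight rate n A)"
  proof -
    have "excess A n \<le> mean_drop n - y \<longleftrightarrow> exp (t * y) \<le> (\<Prod>k=1..n. F k A)" for A
      unfolding prodF exp_le_cancel_iff mult_le_cancel_left_pos[OF t(1)] by linarith
    then show ?thesis by (simp only:)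
  qed
  also have "\<dots> \<le> exp (n * (t * (1 / (2 * p)))\<^sup>2) / exp (t * y)"
    by (rule markov_sum[OF _ _ _ _ mgf]) (auto simp: prodF[unfolded One_nat_def] intro!: weight_nonneg rate_unit)
  also have "\<dots> = exp (- (p\<^sup>2 * y\<^sup>2 / n))"
    unfolding exp_diff[symmetric] t_def using n p_pos by (simp add: power2_eq_square field_simps)
  finally show ?thesis .
qed

definition likelihood_ratio where
  "likelihood_ratio n A = (\<Prod>k=1..n. trans_prob rate A k / trans_prob (\<lambda>_. q) A k)"

text \<open>One step has conditional mean \<open>1 + (q - r)\<^sup>2 / (p q)\<close>, a \<open>\<chi>\<^sup>2\<close>-divergence, and so deviations of the
  transition probabilities enter only quadratically. The relation \<open>p\<^sup>3 = q\<^sup>2\<close> serves to simplify the constant.\<close>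

lemma likelihood_ratio_mean:
  "(\<Sum>A\<in>Pow {1..n}. weight rate n A * likelihood_ratio n A)
     \<le> exp (\<delta>\<^sup>2 / q * (\<Sum>k=1..n. 1 / (ln (2 * real k))\<^sup>2))"
proof -
  have "(\<Sum>A\<in>Pow {1..n}. weight rate n A * likelihood_ratio n A)
      \<le> (\<Prod>k=1..n. exp (\<delta>\<^sup>2 / q * (1 / (ln (2 * real k))\<^sup>2)))"
    unfolding likelihood_ratio_def
  proof (rule sum_weight_prod_le)
    fix k :: nat and A assume k: "1 \<le> k" and A: "free A k" "k \<notin> A"
    define r where "r = rate k"
    have "(1 - r) * ((1 - r) / (1 - q)) + r * (r / q) = 1 + (q - r)\<^sup>2 / (p * q)"
    proof -
      have q1: "1 - q = p" by (simp add: q_eq)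
      have "(1 - r) * ((1 - r) / (1 - q)) + r * (r / q) - (1 + (q - r)\<^sup>2 / (p * q))
          = ((1 - r)\<^sup>2 * q + r\<^sup>2 * p - p * q - (q - r)\<^sup>2) / (p * q)"
        unfolding q1 using p_pos q_pos by (simp add: power2_eq_square field_simps)
      also have "(1 - r)\<^sup>2 * q + r\<^sup>2 * p - p * q - (q - r)\<^sup>2 = 0"
        unfolding q_eq by (simp add: power2_eq_square algebra_simps)
      finally show ?thesis by simp
    qed
    also have "(q - r)\<^sup>2 \<le> (q / p * (\<delta> / ln (2 * real k)))\<^sup>2"
      unfolding r_def using rate_bounds[OF k] by (intro power_mono) auto
    then have "1 + (q - r)\<^sup>2 / (p * q) \<le> 1 + (q / p * (\<delta> / ln (2 * real k)))\<^sup>2 / (p * q)"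
      using p_pos q_pos by (intro add_left_mono divide_right_mono) auto
    also have "(q / p * (\<delta> / ln (2 * real k)))\<^sup>2 / (p * q) = q\<^sup>2 / p ^ 3 * (\<delta>\<^sup>2 / q * (1 / (ln (2 * real k))\<^sup>2))"
      by (simp add: power_divide power_mult_distrib power2_eq_square power3_eq_cube mult_ac)
    also have "q\<^sup>2 / p ^ 3 = 1" using pq q_pos by simp
    finally have "(1 - r) * ((1 - r) / (1 - q)) + r * (r / q) \<le> 1 + \<delta>\<^sup>2 / q * (1 / (ln (2 * real k))\<^sup>2)" by simp
    also have "\<dots> \<le> exp (\<delta>\<^sup>2 / q * (1 / (ln (2 * real k))\<^sup>2))" by (rule exp_ge_add_one_self)
    finally show "(1 - rate k) * (trans_prob rate A k / trans_prob (\<lambda>_. q) A k)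
        + rate k * (trans_prob rate (insert k A) k / trans_prob (\<lambda>_. q) (insert k A) k)
        \<le> exp (\<delta>\<^sup>2 / q * (1 / (ln (2 * real k))\<^sup>2))"
      using A k by (simp add: trans_prob_def free_insert r_def)
  next
    fix k :: nat and A assume "1 \<le> k" "\<not> free A k" "k \<notin> A"
    then show "trans_prob rate A k / trans_prob (\<lambda>_. q) A k \<le> exp (\<delta>\<^sup>2 / q * (1 / (ln (2 * real k))\<^sup>2))"
      using q_pos by (simp add: trans_prob_def)
  next
    fix k :: nat and A assume "1 \<le> k"
    then show "0 \<le> trans_prob rate A k / trans_prob (\<lambda>_. q) A k"
      using rate_unit[of k] q_pos q_less_1 by (intro divide_nonneg_nonneg trans_prob_nonneg) auto
  next
    fix k :: nat and A B :: "nat set" assume "A \<inter> {..k} = B \<inter> {..k}"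
    note trans_prob_cong[OF this]
    then show "trans_prob rate A k / trans_prob (\<lambda>_. q) A k = trans_prob rate B k / trans_prob (\<lambda>_. q) B k"
      by (simp only:)
  qed (auto simp: rate_unit)
  also have "\<dots> = exp (\<delta>\<^sup>2 / q * (\<Sum>k=1..n. 1 / (ln (2 * real k))\<^sup>2))"
    by (simp add: exp_sum[symmetric] sum_distrib_left)
  finally show ?thesis .
qed

definition overweight where
  "overweight c n A \<longleftrightarrow> exp (real n * ln p - c * scale n) < weight rate n A"

lemma weight_rate_eq:
  assumes "admissible A"
  shows "weight rate n A = exp (ln p * (real n + excess A n)) * likelihood_ratio n A"
proof -
  have "trans_prob (\<lambda>_. q) A k \<noteq> 0" if "1 \<le> k" for k
    using admissible_free[OF assms _ that] q_pos q_less_1 by (auto simp: trans_prob_def)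
  then have "weight rate n A = weight (\<lambda>_. q) n A * likelihood_ratio n A"
    unfolding weight_def likelihood_ratio_def prod.distrib[symmetric] by (intro prod.cong) auto
  then show ?thesis using weight_q[OF assms, of n] by (simp add: excess_def)
qed

text \<open>A word is overweight only if its likelihood ratio is atypically large or its \<open>excess\<close> is
  atypically small. The hypothesis makes \<open>\<delta>\<close> small enough for the linear gain in the mean of \<open>excess\<close>
  to exceed the quadratic cost of the likelihood ratio by a factor of two.\<close>

lemma overweight_mass:
  assumes \<delta>: "24 * \<delta> \<le> - ln p * (density * ln 2 / 8) * q"
  defines "y \<equiv> \<lambda>n. density * \<delta> * ln 2 / 16 * scale n"
  shows "\<forall>\<^sub>F n in sequentially. (\<Sum>A | A \<in> Pow {1..n} \<and> overweight (6 * \<delta>\<^sup>2 / q) n A. weight rate n A)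
    \<le> exp (- (\<delta>\<^sup>2 / q * scale n)) + exp (- (p\<^sup>2 * (y n)\<^sup>2 / n))"
proof -
  have "\<forall>\<^sub>F n in sequentially. real n / (ln (4 * real n))\<^sup>2 \<le> real n" by real_asymp
  moreover have "\<forall>\<^sub>F n in sequentially. 0 < real n / (ln (4 * real n))\<^sup>2" by real_asymp
  ultimately show ?thesis
    using mean_drop_eventually sum_inverse_log_squared
  proof eventually_elim
    case (elim n)
    define \<rho> where "\<rho> = 6 * \<delta>\<^sup>2 / q * scale n"
    have sc: "0 < scale n" "scale n \<le> real n" using elim(1,2) by (auto simp: scale_def)
    have b: "0 < density * \<delta> * ln 2 / 16" "density * \<delta> * ln 2 / 16 \<le> 1"
    proof -
      show "0 < density * \<delta> * ln 2 / 16" using density_bounds \<delta>_pos by simp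
      have "density * \<delta> * ln 2 \<le> 1 * 1 * 1"
        using density_bounds \<delta>_pos \<delta>_le_1 ln_2_less_1 by (intro mult_mono) auto
      then show "density * \<delta> * ln 2 / 16 \<le> 1" by simp
    qed
    have y: "0 < y n" "y n \<le> real n"
    proof -
      show "0 < y n" using b sc by (simp only: y_def mult_pos_pos)
      have "y n \<le> 1 * scale n" unfolding y_def using b sc by (intro mult_right_mono) auto
      then show "y n \<le> real n" using sc by simp
    qed
    have y2: "mean_drop n - y n \<ge> y n" using elim(3) by (simp add: y_def mult_ac)
    let ?R = "{A. A \<in> Pow {1..n} \<and> overweight (6 * \<delta>\<^sup>2 / q) n A}"
    let ?A = "{A. A \<in> Pow {1..n} \<and> exp \<rho> \<le> likelihood_ratio n A}"
    let ?B = "{A. A \<in> Pow {1..n} \<and> excess A n \<le> mean_drop n - y n}"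
    have lr0: "0 \<le> likelihood_ratio n A" for A
      unfolding likelihood_ratio_def using rate_unit q_pos q_less_1
      by (intro prod_nonneg divide_nonneg_nonneg trans_prob_nonneg ballI) auto
    have w0: "0 \<le> weight rate n A" for A by (intro weight_nonneg rate_unit)
    have "?R \<subseteq> ?A \<union> ?B"
    proof (rule ccontr)
      assume "\<not> ?R \<subseteq> ?A \<union> ?B"
      then obtain A where "A \<in> ?R" "A \<notin> ?A" "A \<notin> ?B" by blast
      then have A: "A \<in> Pow {1..n}" "overweight (6 * \<delta>\<^sup>2 / q) n A"
        "likelihood_ratio n A < exp \<rho>" "mean_drop n - y n < excess A n" by (auto simp: not_le)
      have "weight rate n A \<noteq> 0" using A(2) unfolding overweight_def by (metis exp_gt_zero less_asym)
      then have adm: "admissible A" using A(1) by (intro admissible_if_weight_nonzero) auto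
      have "weight rate n A \<le> exp (ln p * (real n + y n)) * exp \<rho>"
        unfolding weight_rate_eq[OF adm] using A(3,4) y2 ln_p_neg lr0
        by (intro mult_mono) auto
      also have "\<dots> = exp (ln p * real n + ln p * y n + \<rho>)" by (simp add: exp_add[symmetric] algebra_simps)
      also have "\<dots> \<le> exp (real n * ln p - 6 * \<delta>\<^sup>2 / q * scale n)"
      proof -
        have "24 * \<delta> * (\<delta> / q * scale n / 2) \<le> - ln p * (density * ln 2 / 8) * q * (\<delta> / q * scale n / 2)"
          using \<delta> \<delta>_pos q_pos sc by (intro mult_right_mono) auto
        also have "\<dots> = - ln p * y n" using q_pos by (simp add: y_def)
        finally have "ln p * y n \<le> - 2 * \<rho>" by (simp add: \<rho>_def power2_eq_square mult_ac)
        then show ?thesis by (simp add: \<rho>_def mult.commute)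
      qed
      finally show False using A(2) by (simp add: overweight_def)
    qed
    then have "(\<Sum>A\<in>?R. weight rate n A) \<le> (\<Sum>A\<in>?A \<union> ?B. weight rate n A)"
      using w0 by (intro sum_mono2) auto
    also have "\<dots> \<le> (\<Sum>A\<in>?A. weight rate n A) + (\<Sum>A\<in>?B. weight rate n A)"
      using w0 by (simp add: sum_Un sum_nonneg)
    also have "(\<Sum>A\<in>?A. weight rate n A) \<le> exp (\<delta>\<^sup>2 / q * (\<Sum>k=1..n. 1 / (ln (2 * real k))\<^sup>2)) / exp \<rho>"
      by (rule markov_sum[OF _ _ _ _ likelihood_ratio_mean]) (auto intro: w0 lr0)
    also have "\<dots> \<le> exp (- (\<delta>\<^sup>2 / q * scale n))"
    proof -
      have "\<delta>\<^sup>2 / q * (\<Sum>k=1..n. 1 / (ln (2 * real k))\<^sup>2) \<le> \<delta>\<^sup>2 / q * (5 * scale n)"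
        using elim(4) q_pos by (intro mult_left_mono) auto
      then show ?thesis unfolding exp_diff[symmetric] \<rho>_def by simp
    qed
    also have "(\<Sum>A\<in>?B. weight rate n A) \<le> exp (- (p\<^sup>2 * (y n)\<^sup>2 / n))"
      by (rule excess_lower_tail[OF y])
    finally show ?case by simp
  qed
qed

lemma overweight_mass_summable:
  assumes \<delta>: "24 * \<delta> \<le> - ln p * (density * ln 2 / 8) * q"
  shows "summable (\<lambda>n. \<Sum>A | A \<in> Pow {1..n} \<and> overweight (6 * \<delta>\<^sup>2 / q) n A. weight rate n A)"
proof -
  define a where "a = \<delta>\<^sup>2 / q"
  define b where "b = p\<^sup>2 * (density * \<delta> * ln 2 / 16)\<^sup>2"
  have a: "0 < a" using \<delta>_pos q_pos by (simp add: a_def)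
  have b: "0 < b" using p_pos density_bounds \<delta>_pos by (simp add: b_def)
  have "\<forall>\<^sub>F n in sequentially. exp (- (a * (real n / (ln (4 * real n))\<^sup>2))) \<le> 1 / (real n)\<^sup>2"
    using a by real_asymp
  moreover have "\<forall>\<^sub>F n in sequentially. exp (- (b * (real n / (ln (4 * real n))^4))) \<le> 1 / (real n)\<^sup>2"
    using b by real_asymp
  ultimately have "\<forall>\<^sub>F n in sequentially.
      norm (\<Sum>A | A \<in> Pow {1..n} \<and> overweight (6 * \<delta>\<^sup>2 / q) n A. weight rate n A) \<le> 2 * (inverse (real n ^ 2))"
    using overweight_mass[OF \<delta>] eventually_gt_at_top[of 0]
  proof eventually_elim
    case (elim n)
    have "p\<^sup>2 * (density * \<delta> * ln 2 / 16 * scale n)\<^sup>2 / n = b * (real n / (ln (4 * real n))^4)"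
      using elim(4) by (simp add: b_def scale_def power_mult_distrib power_divide field_simps power2_eq_square power4_eq_xxxx)
    then have "(\<Sum>A | A \<in> Pow {1..n} \<and> overweight (6 * \<delta>\<^sup>2 / q) n A. weight rate n A)
        \<le> exp (- (a * (real n / (ln (4 * real n))\<^sup>2))) + exp (- (b * (real n / (ln (4 * real n))^4)))"
      using elim(3) by (simp only: a_def scale_def)
    also have "\<dots> \<le> 2 * inverse (real n ^ 2)" using elim(1,2) by (simp add: inverse_eq_divide)
    finally show ?case
      by (simp add: sum_nonneg weight_nonneg rate_unit)
  qed
  then show ?thesis
    by (rule summable_comparison_test_ev) (intro summable_mult inverse_power_summable, simp)
qed

end

section \<open>The mass distribution principle\<close>

text \<open>Independent coins \<open>\<omega>\<close> produce the digits: a free digit copies its coin, a forced digit is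
  zero.\<close>

fun generated_digit :: "(nat \<Rightarrow> bool) \<Rightarrow> nat \<Rightarrow> bool" where
  "generated_digit \<omega> k =
     (if k = 0 then False else \<omega> k \<and> (odd k \<or> \<not> generated_digit \<omega> (k div 2)))"

declare generated_digit.simps[simp del]

definition generated :: "(nat \<Rightarrow> bool) \<Rightarrow> nat set" where
  "generated \<omega> = {k. generated_digit \<omega> k}"

lemma mem_generated: "1 \<le> k \<Longrightarrow> k \<in> generated \<omega> \<longleftrightarrow> \<omega> k \<and> free (generated \<omega>) k"
  unfolding generated_def free_def by (simp add: generated_digit.simps[of \<omega> k])

lemma admissible_generated: "admissible (generated \<omega>)"
  unfolding admissible_def by (auto simp: mem_generated[of "2 * _"] free_def)

context golden_drift begin

definition coins :: "(nat \<Rightarrow> bool) measure" where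
  "coins = PiM UNIV (\<lambda>k. measure_pmf (bernoulli_pmf (rate k)))"

text \<open>Only the coins at the free positions of the word \<open>A\<close> are prescribed, so this is a product set
  that contains the event that the generated word is \<open>A\<close>.\<close>

definition prefix_event :: "nat \<Rightarrow> nat set \<Rightarrow> (nat \<Rightarrow> bool) set" where
  "prefix_event n A = (if admissible A then {\<omega>. \<forall>k\<in>{1..n}. free A k \<longrightarrow> \<omega> k = (k \<in> A)} else {})"

lemma mem_prefix_event: "\<omega> \<in> prefix_event n (generated \<omega> \<inter> {1..n})"
proof -
  have adm: "admissible (generated \<omega> \<inter> {1..n})"
    using admissible_generated[of \<omega>] by (auto simp: admissible_def)
  have "\<omega> k = (k \<in> generated \<omega>)" if k: "k \<in> {1..n}" "free (generated \<omega> \<inter> {1..n}) k" for k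
  proof -
    have "free (generated \<omega>) k" using k unfolding free_def by auto
    then show ?thesis using mem_generated[of k \<omega>] k by auto
  qed
  then show ?thesis using adm by (auto simp: prefix_event_def)
qed

lemma prefix_event_emeasure:
  shows "prefix_event n A \<in> sets coins" "emeasure coins (prefix_event n A) \<le> ennreal (weight rate n A)"
proof -
  interpret P: product_prob_space "\<lambda>k. measure_pmf (bernoulli_pmf (rate k))" UNIV
    by unfold_locales
  have "prefix_event n A \<in> sets coins \<and> emeasure coins (prefix_event n A) \<le> ennreal (weight rate n A)"
  proof (cases "admissible A")
    case True
    define J where "J = {k \<in> {1..n}. free A k}"
    define X where "X = (\<lambda>k. {k \<in> A})"
    have J: "finite J" by (simp add: J_def)
    have ev: "prefix_event n A = prod_emb UNIV (\<lambda>k. measure_pmf (bernoulli_pmf (rate k))) J (Pi\<^sub>E J X)"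
    proof -
      have "prod_emb UNIV (\<lambda>k. measure_pmf (bernoulli_pmf (rate k))) J (Pi\<^sub>E J X)
          = {\<omega>. \<forall>k\<in>J. \<omega> k \<in> X k}"
        by (simp add: prod_emb_def vimage_def restrict_PiE_iff PiE_UNIV_domain Pi_def Ball_def)
      also have "\<dots> = prefix_event n A"
        unfolding prefix_event_def if_P[OF True] J_def X_def by blast
      finally show ?thesis ..
    qed
    have "emeasure coins (prefix_event n A) = (\<Prod>k\<in>J. emeasure (measure_pmf (bernoulli_pmf (rate k))) (X k))"
      unfolding coins_def ev using J by (intro P.emeasure_PiM_emb) auto
    also have "\<dots> = (\<Prod>k\<in>J. ennreal (trans_prob rate A k))"
    proof (rule prod.cong[OF refl])
      fix k assume "k \<in> J"
      then show "emeasure (measure_pmf (bernoulli_pmf (rate k))) (X k) = ennreal (trans_prob rate A k)"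
        using rate_unit[of k] by (auto simp: X_def J_def trans_prob_def emeasure_pmf_single)
    qed
    also have "\<dots> = ennreal (\<Prod>k\<in>J. trans_prob rate A k)"
      by (rule prod_ennreal) (auto simp: J_def intro!: trans_prob_nonneg rate_bounds(1) conjunct2[OF rate_unit])
    also have "(\<Prod>k\<in>J. trans_prob rate A k) = weight rate n A"
      unfolding weight_def J_def
      by (rule prod.mono_neutral_left) (auto simp: trans_prob_def dest: admissible_free[OF True])
    finally have "emeasure coins (prefix_event n A) = ennreal (weight rate n A)" .
    moreover have "prefix_event n A \<in> sets coins"
      unfolding ev coins_def using J by (intro sets_PiM_I) auto
    ultimately show ?thesis by simp
  qed (simp add: prefix_event_def)
  then show "prefix_event n A \<in> sets coins" "emeasure coins (prefix_event n A) \<le> ennreal (weight rate n A)" by auto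
qed

lemma coins_UNIV: "emeasure coins UNIV = 1"
proof -
  interpret P: product_prob_space "\<lambda>k. measure_pmf (bernoulli_pmf (rate k))" UNIV
    by unfold_locales
  have "space coins = UNIV" by (simp add: coins_def space_PiM)
  then show ?thesis using P.emeasure_space_1 by (simp add: coins_def)
qed

lemma emeasure_prefix_events_le:
  assumes "finite R"
  shows "(\<Union>A\<in>R. prefix_event n A) \<in> sets coins"
    "emeasure coins (\<Union>A\<in>R. prefix_event n A) \<le> ennreal (\<Sum>A\<in>R. weight rate n A)"
proof -
  show "(\<Union>A\<in>R. prefix_event n A) \<in> sets coins" using assms prefix_event_emeasure(1) by auto
  have "emeasure coins (\<Union>A\<in>R. prefix_event n A) \<le> (\<Sum>A\<in>R. emeasure coins (prefix_event n A))"
    using assms prefix_event_emeasure(1) by (intro emeasure_subadditive_finite) auto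
  also have "\<dots> \<le> (\<Sum>A\<in>R. ennreal (weight rate n A))" by (intro sum_mono prefix_event_emeasure(2))
  also have "\<dots> = ennreal (\<Sum>A\<in>R. weight rate n A)"
    by (intro sum_ennreal weight_nonneg rate_unit)
  finally show "emeasure coins (\<Union>A\<in>R. prefix_event n A) \<le> ennreal (\<Sum>A\<in>R. weight rate n A)" .
qed

text \<open>From some length on, overweight prefixes have total mass at most \<open>1 / 2\<close>. Every coin sequence
  either generates such a prefix, or its point lies in some \<open>U j\<close> and its prefix of length \<open>n j\<close> is one of
  at most three words that are not overweight.\<close>

lemma mass_distribution:
  assumes \<delta>: "24 * \<delta> \<le> - ln p * (density * ln 2 / 8) * q"
  defines "c \<equiv> 6 * \<delta>\<^sup>2 / q"
  shows "\<exists>N. \<forall>(U :: nat \<Rightarrow> real set) n. Xi_G \<subseteq> (\<Union>j. U j) \<longrightarrow>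
    (\<forall>j. bounded (U j) \<and> diameter (U j) \<le> 1 / 2 ^ n j \<and> N \<le> n j) \<longrightarrow>
    1 \<le> ennreal (1 / 2) + (\<Sum>j. ennreal (3 * exp (real (n j) * ln p - c * scale (n j))))"
proof -
  define R where "R = (\<lambda>n. {A. A \<in> Pow {1..n} \<and> overweight c n A})"
  define m where "m = (\<lambda>n. \<Sum>A\<in>R n. weight rate n A)"
  have m: "summable m" using overweight_mass_summable[OF \<delta>] by (simp add: m_def R_def c_def)
  have m0: "0 \<le> m n" for n unfolding m_def by (intro sum_nonneg weight_nonneg rate_unit)
  obtain N where N: "(\<Sum>i. m (i + N)) \<le> 1 / 2"
  proof -
    obtain N where "norm (\<Sum>i. m (i + N)) < 1 / 2"
      using suminf_exist_split[OF _ m, of "1 / 2"] by auto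
    then have "(\<Sum>i. m (i + N)) \<le> 1 / 2" unfolding real_norm_def by linarith
    then show ?thesis by (rule that)
  qed
  show ?thesis
  proof (intro exI[of _ N] allI impI)
    fix U :: "nat \<Rightarrow> real set" and n :: "nat \<Rightarrow> nat"
    assume cov: "Xi_G \<subseteq> (\<Union>j. U j)"
      and U: "\<forall>j. bounded (U j) \<and> diameter (U j) \<le> 1 / 2 ^ n j \<and> N \<le> n j"
    define Bad where "Bad = (\<lambda>i. \<Union>A\<in>R (i + N). prefix_event (i + N) A)"
    define W where "W = (\<lambda>j. prefixes (n j) (U j) - R (n j))"
    define Good where "Good = (\<lambda>j. \<Union>A\<in>W j. prefix_event (n j) A)"
    have finR: "finite (R k)" for k by (simp add: R_def)
    have preP: "prefixes k V \<subseteq> Pow {1..k}" for k V by (auto simp: prefixes_def)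
    then have finP: "finite (prefixes k V)" for k V by (rule finite_subset) simp
    have finW: "finite (W j)" for j using finP by (simp add: W_def)
    have "UNIV \<subseteq> (\<Union>i. Bad i) \<union> (\<Union>j. Good j)"
    proof
      fix \<omega> :: "nat \<Rightarrow> bool"
      have "point (generated \<omega>) \<in> Xi_G" using admissible_generated by (auto simp: Xi_G_eq)
      then obtain j where j: "point (generated \<omega>) \<in> U j" using cov by auto
      define A where "A = generated \<omega> \<inter> {1..n j}"
      have A: "A \<in> prefixes (n j) (U j)" using j admissible_generated by (auto simp: prefixes_def A_def)
      have ev: "\<omega> \<in> prefix_event (n j) A" unfolding A_def by (rule mem_prefix_event)
      show "\<omega> \<in> (\<Union>i. Bad i) \<union> (\<Union>j. Good j)"
      proof (cases "A \<in> R (n j)")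
        case True
        have "n j - N + N = n j" using U by simp
        then have "\<omega> \<in> Bad (n j - N)" using True ev by (auto simp: Bad_def)
        then show ?thesis by blast
      next
        case False
        then have "\<omega> \<in> Good j" using A ev by (auto simp: Good_def W_def)
        then show ?thesis by blast
      qed
    qed
    then have "(\<Union>i. Bad i) \<union> (\<Union>j. Good j) = UNIV" by (rule subset_antisym[OF subset_UNIV])
    then have "1 = emeasure coins ((\<Union>i. Bad i) \<union> (\<Union>j. Good j))" by (simp only: coins_UNIV)
    also have "\<dots> \<le> emeasure coins (\<Union>i. Bad i) + emeasure coins (\<Union>j. Good j)"
      using emeasure_prefix_events_le(1)[OF finR] emeasure_prefix_events_le(1)[OF finW]
      by (intro emeasure_subadditive sets.countable_UN) (auto simp: Bad_def Good_def)
    also have "\<dots> \<le> (\<Sum>i. emeasure coins (Bad i)) + (\<Sum>j. emeasure coins (Good j))"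
      using emeasure_prefix_events_le(1)[OF finR] emeasure_prefix_events_le(1)[OF finW]
      by (intro add_mono emeasure_subadditive_countably) (auto simp: Bad_def Good_def)
    also have "\<dots> \<le> (\<Sum>i. ennreal (m (i + N))) + (\<Sum>j. ennreal (3 * exp (real (n j) * ln p - c * scale (n j))))"
    proof (intro add_mono suminf_le summableI)
      fix i show "emeasure coins (Bad i) \<le> ennreal (m (i + N))"
        unfolding Bad_def m_def by (rule emeasure_prefix_events_le(2)[OF finR])
    next
      fix j
      have "emeasure coins (Good j) \<le> ennreal (\<Sum>A\<in>W j. weight rate (n j) A)"
        unfolding Good_def by (rule emeasure_prefix_events_le(2)[OF finW])
      also have "\<dots> \<le> ennreal (\<Sum>A\<in>W j. exp (real (n j) * ln p - c * scale (n j)))"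
        using preP by (intro ennreal_leI sum_mono) (force simp: W_def R_def overweight_def not_less)
      also have "\<dots> \<le> ennreal (3 * exp (real (n j) * ln p - c * scale (n j)))"
      proof -
        have "card (W j) \<le> card (prefixes (n j) (U j))"
          unfolding W_def using finP by (intro card_mono) auto
        also have "\<dots> \<le> 3"
        proof (rule card_prefixes_le)
          fix x y assume "x \<in> U j" "y \<in> U j"
          then have "dist x y \<le> diameter (U j)" using U by (intro diameter_bounded_bound) auto
          then show "\<bar>x - y\<bar> \<le> 1 / 2 ^ n j" using U by (auto simp: dist_real_def intro: order_trans)
        qed
        finally have "real (card (W j)) \<le> 3" by simp
        then show ?thesis by (intro ennreal_leI) (simp add: mult_right_mono)
      qed
      finally show "emeasure coins (Good j) \<le> ennreal (3 * exp (real (n j) * ln p - c * scale (n j)))" .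
    qed
    also have "\<dots> \<le> ennreal (1 / 2) + (\<Sum>j. ennreal (3 * exp (real (n j) * ln p - c * scale (n j))))"
    proof (rule add_right_mono)
      have "(\<Sum>i. ennreal (m (i + N))) = ennreal (\<Sum>i. m (i + N))"
        using m m0 by (intro suminf_ennreal2) (auto simp: summable_iff_shift)
      also have "\<dots> \<le> ennreal (1 / 2)" by (rule ennreal_leI[OF N])
      finally show "(\<Sum>i. ennreal (m (i + N))) \<le> ennreal (1 / 2)" .
    qed
    finally show "1 \<le> ennreal (1 / 2) + (\<Sum>j. ennreal (3 * exp (real (n j) * ln p - c * scale (n j))))" .
  qed
qed

end

section \<open>Gauges and dimension\<close>

lemma dyadic_scale:
  fixes d :: real
  assumes "0 < d" "d \<le> 1 / 2 ^ N"
  shows "\<exists>n\<ge>N. d \<le> 1 / 2 ^ n \<and> 1 / 2 ^ Suc n < d"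
proof -
  obtain m where m: "1 / 2 ^ m < d"
    using real_arch_pow_inv[OF assms(1), of "1/2"] by (auto simp: power_one_over)
  define k where "k = (LEAST m. 1 / 2 ^ m < d)"
  have k: "1 / 2 ^ k < d" unfolding k_def using m by (rule LeastI)
  have kN: "N < k"
  proof (rule ccontr)
    assume "\<not> N < k"
    then have "1 / 2 ^ N \<le> (1 / 2 ^ k :: real)" by (intro divide_left_mono power_increasing) auto
    then show False using assms(2) k by simp
  qed
  then obtain n where n: "k = Suc n" by (cases k) auto
  then have "\<not> 1 / 2 ^ n < d" unfolding k_def by (metis k_def lessI not_less_Least)
  then show ?thesis using k kN n by (intro exI[of _ n]) auto
qed

text \<open>Of the total mass \<open>1\<close>, at most \<open>1 / 2\<close> is carried by overweight prefixes and at most \<open>1 / 4\<close> by the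
  sets of diameter zero; the remaining \<open>1 / 4\<close> is \<open>3 / p\<close> times the lower bound.\<close>

lemma sum_gauge_lower:
  fixes a :: "nat \<Rightarrow> real" and x :: "nat \<Rightarrow> ennreal"
  assumes "1 \<le> ennreal (1 / 2) + (\<Sum>j. ennreal (3 * a j))" "0 < p"
    and "\<And>j. ennreal (3 * a j) \<le> ennreal (3 / p) * x j + ennreal (1 / 4 * (1/2) ^ Suc j)"
  shows "ennreal (p / 12) \<le> (\<Sum>j. x j)"
proof -
  have "(\<Sum>j. ennreal (3 * a j)) \<le> (\<Sum>j. ennreal (3 / p) * x j + ennreal (1 / 4 * (1/2) ^ Suc j))"
    by (intro suminf_le summableI assms(3))
  also have "\<dots> = ennreal (3 / p) * (\<Sum>j. x j) + (\<Sum>j. ennreal (1 / 4 * (1/2) ^ Suc j))"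
    by (simp add: suminf_add[symmetric] ennreal_suminf_cmult del: power_Suc)
  also have "(\<Sum>j. ennreal (1 / 4 * (1/2) ^ Suc j)) = ennreal (1 / 4)"
    by (rule suminf_ennreal_eq) (use sums_mult[OF power_half_series, of "1 / 4"] in auto)
  finally have le: "1 \<le> ennreal (1 / 2) + (ennreal (3 / p) * (\<Sum>j. x j) + ennreal (1 / 4))"
    using assms(1) order_trans add_left_mono by blast
  show ?thesis
  proof (cases "\<Sum>j. x j")
    case (real S)
    have nn: "0 \<le> 3 / p" "0 \<le> S" "0 \<le> 3 / p * S" "0 \<le> 3 / p * S + 1 / 4" "(0 :: real) \<le> 1 / 4" "(0 :: real) \<le> 1 / 2"
      using real assms(2) by auto
    have "1 \<le> ennreal (1 / 2 + (3 / p * S + 1 / 4))"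
      using le unfolding real(2) ennreal_mult[OF nn(1,2), symmetric] ennreal_plus[OF nn(3,5), symmetric]
        ennreal_plus[OF nn(6,4), symmetric] .
    then have "1 \<le> 1 / 2 + (3 / p * S + 1 / 4)" by (simp only: ennreal_ge_1)
    then show ?thesis using real assms(2) by (simp add: field_simps ennreal_leI)
  qed simp
qed

definition corrected_gauge :: "real \<Rightarrow> real \<Rightarrow> real \<Rightarrow> real" where
  "corrected_gauge s c t = t powr s * exp (- c * (\<bar>ln t\<bar> / (ln \<bar>ln t\<bar>)\<^sup>2))"

context golden begin

text \<open>Passing from scale \<open>n\<close> to \<open>n + 1\<close> in the power costs the factor \<open>p\<close>; the change in the
  correction is left to \<open>e\<close>, for which \<open>scale n\<close> will do when \<open>n\<close> is large, because \<open>ln 2 < 1\<close>.\<close>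

lemma gauge_lower:
  assumes "0 \<le> c" and n: "0 < ln (real n * ln 2)"
    and cmp: "(real n + 1) * ln 2 / (ln (real n * ln 2))\<^sup>2 \<le> e"
    and d: "d \<le> 1 / 2 ^ n" "1 / 2 ^ Suc n < d"
  shows "p * exp (real n * ln p - c * e) \<le> corrected_gauge s c d"
proof -
  have d0: "0 < d" using d(2) by (rule less_trans[rotated]) simp
  have nn: "0 < real n * ln 2" using n by (cases "n = 0") auto
  have "ln d \<le> ln (1 / 2 ^ n)" using d(1) d0 by (subst ln_le_cancel_iff) auto
  then have l1: "real n * ln 2 \<le> - ln d" by (simp add: ln_div ln_realpow)
  have "ln (1 / 2 ^ Suc n) \<le> ln d" using d(2) d0 by (subst ln_le_cancel_iff) auto
  then have l2: "- ln d \<le> (real n + 1) * ln 2"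
    by (simp add: ln_div ln_realpow del: power_Suc) (simp add: algebra_simps)
  have abs: "\<bar>ln d\<bar> = - ln d" using l1 nn by linarith
  have pw: "exp (ln p + real n * ln p) \<le> d powr s"
  proof -
    have "s * (- ln d) \<le> s * ((real n + 1) * ln 2)" using l2 s_pos by (intro mult_left_mono) auto
    also have "\<dots> = - (ln p + real n * ln p)" by (simp add: s_def algebra_simps)
    finally show ?thesis using d0 by (simp add: powr_def)
  qed
  have "- ln d / (ln (- ln d))\<^sup>2 \<le> (real n + 1) * ln 2 / (ln (real n * ln 2))\<^sup>2"
    using l1 l2 nn n by (intro frac_le power_mono) auto
  also note cmp
  finally have "- (c * e) \<le> - c * (\<bar>ln d\<bar> / (ln \<bar>ln d\<bar>)\<^sup>2)"
    unfolding abs using mult_left_mono[OF _ assms(1)] by fastforce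
  then have "exp (ln p + real n * ln p) * exp (- (c * e)) \<le> corrected_gauge s c d"
    unfolding corrected_gauge_def using pw by (intro mult_mono) auto
  moreover have "exp (ln p + real n * ln p) * exp (- (c * e)) = p * exp (real n * ln p - c * e)"
    using p_pos by (simp add: exp_add exp_diff exp_minus field_simps)
  ultimately show ?thesis by simp
qed

text \<open>A covering set of positive diameter is assigned its dyadic scale. The gauge vanishes on a
  set of diameter zero, and such a set is assigned a scale so fine that
  all of these sets together contribute at most \<open>1 / 4\<close>.\<close>

lemma corrected_gauge_positive_measure:
  "\<exists>c>0. 0 < hausdorff_measure (corrected_gauge s c) Xi_G"
proof -
  define b where "b = - ln p * (density * ln 2 / 8) * q"
  have b: "0 < b" unfolding b_def using ln_p_neg density_bounds q_pos by (intro mult_pos_pos) auto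
  define \<delta> where "\<delta> = min 1 (b / 24)"
  interpret golden_drift p q \<delta>
    by unfold_locales (use b in \<open>auto simp: \<delta>_def\<close>)
  have \<delta>b: "24 * \<delta> \<le> - ln p * (density * ln 2 / 8) * q"
    unfolding b_def[symmetric] by (simp add: \<delta>_def)
  define c where "c = 6 * \<delta>\<^sup>2 / q"
  have c: "0 < c" using \<delta>_pos q_pos by (simp add: c_def)
  obtain N1 where N1: "\<And>(U :: nat \<Rightarrow> real set) n. Xi_G \<subseteq> (\<Union>j. U j) \<Longrightarrow>
    (\<And>j. bounded (U j)) \<Longrightarrow> (\<And>j. diameter (U j) \<le> 1 / 2 ^ n j) \<Longrightarrow> (\<And>j. N1 \<le> n j) \<Longrightarrow>
    1 \<le> ennreal (1 / 2) + (\<Sum>j. ennreal (3 * exp (real (n j) * ln p - c * scale (n j))))"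
    using mass_distribution[OF \<delta>b] unfolding c_def by meson
  have "\<forall>\<^sub>F n in sequentially. 0 < ln (real n * ln 2)" by real_asymp
  moreover have "\<forall>\<^sub>F n in sequentially. (real n + 1) * ln 2 / (ln (real n * ln 2))\<^sup>2 \<le> real n / (ln (4 * real n))\<^sup>2"
  proof -
    have "(\<lambda>n. ((real n + 1) * ln 2 / (ln (real n * ln 2))\<^sup>2) / (real n / (ln (4 * real n))\<^sup>2)) \<longlonglongrightarrow> ln 2"
      by real_asymp
    then have "\<forall>\<^sub>F n in sequentially. ((real n + 1) * ln 2 / (ln (real n * ln 2))\<^sup>2) / (real n / (ln (4 * real n))\<^sup>2) < 1"
      by (rule order_tendstoD(2)) (rule ln_2_less_1)
    moreover have "\<forall>\<^sub>F n in sequentially. 0 < real n / (ln (4 * real n))\<^sup>2" by real_asymp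
    ultimately show ?thesis by eventually_elim (simp only: divide_less_eq_1_pos less_imp_le)
  qed
  ultimately have "\<forall>\<^sub>F n in sequentially. 0 < ln (real n * ln 2) \<and>
      (real n + 1) * ln 2 / (ln (real n * ln 2))\<^sup>2 \<le> scale n"
    unfolding scale_def by (rule eventually_conj)
  then obtain N2 where N2: "\<And>n. n \<ge> N2 \<Longrightarrow> 0 < ln (real n * ln 2)"
      "\<And>n. n \<ge> N2 \<Longrightarrow> (real n + 1) * ln 2 / (ln (real n * ln 2))\<^sup>2 \<le> scale n"
    unfolding eventually_sequentially by blast
  define N where "N = max N1 N2"
  have tiny: "\<exists>n\<ge>N. 3 * exp (real n * ln p - c * scale n) \<le> e" if "0 < e" for e
  proof -
    have "\<forall>\<^sub>F n in sequentially. 3 * exp (real n * ln p) \<le> e" using that ln_p_neg by real_asymp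
    then have "\<forall>\<^sub>F n in sequentially. 3 * exp (real n * ln p) \<le> e \<and> N \<le> n"
      using eventually_ge_at_top by (rule eventually_conj)
    then obtain n where n: "3 * exp (real n * ln p) \<le> e" "N \<le> n"
      unfolding eventually_sequentially by blast
    have "exp (real n * ln p - c * scale n) \<le> exp (real n * ln p)"
      using c by (simp add: scale_def)
    then have "3 * exp (real n * ln p - c * scale n) \<le> e" using n(1) by linarith
    then show ?thesis using n(2) by blast
  qed
  have "ennreal (p / 12) \<le> hausdorff_content (corrected_gauge s c) (1 / 2 ^ N) Xi_G"
    unfolding hausdorff_content_def
  proof (rule INF_greatest)
    fix U :: "nat \<Rightarrow> real set"
    assume "U \<in> {U. Xi_G \<subseteq> (\<Union>j. U j) \<and> (\<forall>j. bounded (U j) \<and> diameter (U j) \<le> 1 / 2 ^ N)}"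
    then have U: "Xi_G \<subseteq> (\<Union>j. U j)" "\<And>j. bounded (U j)" "\<And>j. diameter (U j) \<le> 1 / 2 ^ N" by auto
    have "\<exists>n\<ge>N. diameter (U j) \<le> 1 / 2 ^ n \<and> ennreal (3 * exp (real n * ln p - c * scale n))
        \<le> ennreal (3 / p) * ennreal (corrected_gauge s c (diameter (U j))) + ennreal (1 / 4 * (1/2) ^ Suc j)" for j
    proof (cases "diameter (U j) = 0")
      case True
      obtain n where "n \<ge> N" "3 * exp (real n * ln p - c * scale n) \<le> 1 / 4 * (1/2) ^ Suc j"
        using tiny[of "1 / 4 * (1/2) ^ Suc j"] by auto
      then show ?thesis using True
        by (intro exI[of _ n]) (auto intro!: ennreal_leI add_increasing simp del: power_Suc)
    next
      case False
      then have "0 < diameter (U j)" using diameter_ge_0[OF U(2), of j] by simp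
      then obtain n where n: "n \<ge> N" "diameter (U j) \<le> 1 / 2 ^ n" "1 / 2 ^ Suc n < diameter (U j)"
        using dyadic_scale[OF _ U(3)] by blast
      have "p * exp (real n * ln p - c * scale n) \<le> corrected_gauge s c (diameter (U j))"
        by (rule gauge_lower) (use n c N2[of n] in \<open>auto simp: N_def\<close>)
      then have "3 * exp (real n * ln p - c * scale n) \<le> 3 / p * corrected_gauge s c (diameter (U j))"
        using p_pos by (simp add: field_simps)
      then have "ennreal (3 * exp (real n * ln p - c * scale n)) \<le> ennreal (3 / p) * ennreal (corrected_gauge s c (diameter (U j)))"
        using p_pos by (simp add: ennreal_mult'[symmetric] ennreal_leI)
      then show ?thesis using n(1,2) by (intro exI[of _ n]) (auto intro: add_increasing2)
    qed
    then obtain n where n: "\<And>j. N \<le> n j" "\<And>j. diameter (U j) \<le> 1 / 2 ^ n j"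
      "\<And>j. ennreal (3 * exp (real (n j) * ln p - c * scale (n j)))
        \<le> ennreal (3 / p) * ennreal (corrected_gauge s c (diameter (U j))) + ennreal (1 / 4 * (1/2) ^ Suc j)"
      by metis
    have "1 \<le> ennreal (1 / 2) + (\<Sum>j. ennreal (3 * exp (real (n j) * ln p - c * scale (n j))))"
      by (rule N1[OF U(1,2) n(2)]) (use n(1) in \<open>auto simp: N_def\<close>)
    then show "ennreal (p / 12) \<le> (\<Sum>j. ennreal (corrected_gauge s c (diameter (U j))))"
      by (rule sum_gauge_lower[OF _ p_pos n(3)])
  qed
  also have "\<dots> \<le> hausdorff_measure (corrected_gauge s c) Xi_G"
    by (rule hausdorff_content_le_measure) simp
  finally show ?thesis using c p_pos
    by (intro exI[of _ c]) (auto intro: less_le_trans[of _ "ennreal (p / 12)"])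
qed

text \<open>The gauge of the null result with exponent \<open>1\<close> dominates every \<open>t\<^sup>r\<close> with \<open>r > s\<close>, and the
  corrected gauge is dominated by \<open>t\<^sup>r\<close> for \<open>r < s\<close>.\<close>

lemma hausdorff_dim_Xi_G: "hausdorff_dim Xi_G = ennreal s"
  unfolding hausdorff_dim_def
proof (rule antisym)
  show "(INF r\<in>{r. 0 < r \<and> hausdorff_measure (\<lambda>t. t powr r) Xi_G = 0}. ennreal r) \<le> ennreal s"
  proof (rule ennreal_le_epsilon)
    fix e :: real assume e: "0 < e"
    let ?\<psi> = "\<lambda>t. t powr s * exp (- (\<bar>ln t\<bar> / (ln \<bar>ln t\<bar>) powr 1))"
    have "\<forall>\<^sub>F t in at_right 0. t powr e \<le> exp (- (\<bar>ln t\<bar> / (ln \<bar>ln t\<bar>) powr 1))"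
      using e by real_asymp
    then have "\<forall>\<^sub>F t in at_right 0. t powr (s + e) \<le> 1 * ?\<psi> t"
      by eventually_elim (simp add: powr_add mult_left_mono)
    then have "hausdorff_measure (\<lambda>t. t powr (s + e)) Xi_G \<le> ennreal 1 * hausdorff_measure ?\<psi> Xi_G"
      by (intro hausdorff_measure_le_scaled) auto
    also have "\<dots> = 0" using hausdorff_measure_Xi_G_null[of 1] by simp
    finally have "s + e \<in> {r. 0 < r \<and> hausdorff_measure (\<lambda>t. t powr r) Xi_G = 0}" using s_pos e by simp
    then have "(INF r\<in>{r. 0 < r \<and> hausdorff_measure (\<lambda>t. t powr r) Xi_G = 0}. ennreal r) \<le> ennreal (s + e)"
      by (rule INF_lower)
    then show "(INF r\<in>{r. 0 < r \<and> hausdorff_measure (\<lambda>t. t powr r) Xi_G = 0}. ennreal r) \<le> ennreal s + ennreal e"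
      using s_pos e by simp
  qed
next
  obtain c where c: "0 < c" "0 < hausdorff_measure (corrected_gauge s c) Xi_G"
    using corrected_gauge_positive_measure by blast
  show "ennreal s \<le> (INF r\<in>{r. 0 < r \<and> hausdorff_measure (\<lambda>t. t powr r) Xi_G = 0}. ennreal r)"
  proof (rule INF_greatest, rule ccontr)
    fix r assume r: "r \<in> {r. 0 < r \<and> hausdorff_measure (\<lambda>t. t powr r) Xi_G = 0}" "\<not> ennreal s \<le> ennreal r"
    then have rs: "r < s" by (metis ennreal_leI not_less)
    have "\<forall>\<^sub>F t in at_right 0. (t::real) < 1" "\<forall>\<^sub>F t in at_right 0. (0::real) < t"
      by real_asymp+
    then have "\<forall>\<^sub>F t in at_right 0. corrected_gauge s c t \<le> 1 * t powr r"
    proof eventually_elim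
      case (elim t)
      have "corrected_gauge s c t \<le> t powr s * 1"
        unfolding corrected_gauge_def using c by (intro mult_left_mono) auto
      also have "\<dots> \<le> t powr r" using elim rs by (simp add: powr_mono')
      finally show ?case by simp
    qed
    then have "hausdorff_measure (corrected_gauge s c) Xi_G \<le> ennreal 1 * hausdorff_measure (\<lambda>t. t powr r) Xi_G"
      by (intro hausdorff_measure_le_scaled) (auto simp: corrected_gauge_def)
    then show False using r(1) c(2) by simp
  qed
qed

lemma corrected_gauge_not_sigma_finite:
  assumes "c' < c" "0 < hausdorff_measure (corrected_gauge s c) Xi_G"
  shows "\<not> hausdorff_sigma_finite (corrected_gauge s c') Xi_G"
proof
  assume "hausdorff_sigma_finite (corrected_gauge s c') Xi_G"
  then have "hausdorff_measure (corrected_gauge s c) Xi_G = 0"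
  proof (rule hausdorff_null_if_sigma_finite)
    fix \<eta> :: real assume \<eta>: "0 < \<eta>"
    define a where "a = c - c'"
    have a: "0 < a" using assms(1) by (simp add: a_def)
    have "\<forall>\<^sub>F t in at_right 0. exp (- a * (\<bar>ln t\<bar> / (ln \<bar>ln t\<bar>)\<^sup>2)) \<le> \<eta>"
      using a \<eta> by real_asymp
    then show "\<forall>\<^sub>F t in at_right 0. corrected_gauge s c t \<le> \<eta> * corrected_gauge s c' t"
    proof eventually_elim
      case (elim t)
      define h where "h = \<bar>ln t\<bar> / (ln \<bar>ln t\<bar>)\<^sup>2"
      have "- c * h = - a * h + - c' * h" by (simp add: a_def algebra_simps)
      then have "exp (- c * h) = exp (- a * h) * exp (- c' * h)" by (simp only: exp_add)
      then have "corrected_gauge s c t = exp (- a * h) * corrected_gauge s c' t"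
        by (simp add: corrected_gauge_def h_def)
      also have "\<dots> \<le> \<eta> * corrected_gauge s c' t"
        using elim by (intro mult_right_mono) (auto simp: corrected_gauge_def h_def)
      finally show ?case .
    qed
  qed (auto simp: corrected_gauge_def)
  then show False using assms(2) by simp
qed

end

lemma golden_exists: "\<exists>p q. golden p q"
proof -
  have "\<exists>p\<ge>0. p \<le> 1 \<and> p ^ 3 - (1 - p) ^ 2 = (0::real)"
    by (rule IVT') (auto intro!: continuous_intros)
  then obtain p :: real where p: "0 \<le> p" "p \<le> 1" "p ^ 3 = (1 - p) ^ 2" by auto
  then have "p \<noteq> 0" "p \<noteq> 1" by auto
  then have "golden p (1 - p)" using p by unfold_locales auto
  then show ?thesis by blast
qed

theorem theorem1p2:
  fixes s :: real
  assumes "s = enn2real (hausdorff_dim Xi_G)"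
  shows
    "(hausdorff_measure (\<lambda>t. t powr s) Xi_G = \<infinity> \<and>
      \<not> hausdorff_sigma_finite (\<lambda>t. t powr s) Xi_G \<and>
      (\<forall>\<^sub>F c in at_right 0.
         hausdorff_measure (\<lambda>t. t powr s * exp (- c * (\<bar>ln t\<bar> / (ln \<bar>ln t\<bar>)\<^sup>2))) Xi_G = \<infinity> \<and>
         \<not> hausdorff_sigma_finite (\<lambda>t. t powr s * exp (- c * (\<bar>ln t\<bar> / (ln \<bar>ln t\<bar>)\<^sup>2))) Xi_G)) \<and>
     (\<forall>\<theta><2. hausdorff_measure (\<lambda>t. t powr s * exp (- (\<bar>ln t\<bar> / (ln \<bar>ln t\<bar>) powr \<theta>))) Xi_G = 0)"
proof -
  obtain p q where "golden p q" using golden_exists by blast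
  then interpret golden p q .
  have s: "s = golden.s p" using assms hausdorff_dim_Xi_G s_pos by simp
  obtain c where c: "0 < c" "0 < hausdorff_measure (corrected_gauge s c) Xi_G"
    using corrected_gauge_positive_measure unfolding s by blast
  have not_sf: "\<not> hausdorff_sigma_finite (corrected_gauge s c') Xi_G" if "c' < c" for c'
    using corrected_gauge_not_sigma_finite[OF that] c(2) unfolding s by blast
  have gauge: "corrected_gauge s c' = (\<lambda>t. t powr s * exp (- c' * (\<bar>ln t\<bar> / (ln \<bar>ln t\<bar>)\<^sup>2)))" for c'
    by (rule ext) (rule corrected_gauge_def)
  have power: "corrected_gauge s 0 = (\<lambda>t. t powr s)" by (simp add: gauge)
  have "\<forall>\<^sub>F c' in at_right 0. c' < c" using c(1) unfolding eventually_at_right_field by blast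
  then have "\<forall>\<^sub>F c' in at_right 0. hausdorff_measure (corrected_gauge s c') Xi_G = \<infinity> \<and>
      \<not> hausdorff_sigma_finite (corrected_gauge s c') Xi_G"
    by eventually_elim (simp add: not_sf infinite_measure_if_not_sigma_finite)
  then have "\<forall>\<^sub>F c in at_right 0.
      hausdorff_measure (\<lambda>t. t powr s * exp (- c * (\<bar>ln t\<bar> / (ln \<bar>ln t\<bar>)\<^sup>2))) Xi_G = \<infinity> \<and>
      \<not> hausdorff_sigma_finite (\<lambda>t. t powr s * exp (- c * (\<bar>ln t\<bar> / (ln \<bar>ln t\<bar>)\<^sup>2))) Xi_G"
    unfolding gauge .
  moreover have "\<not> hausdorff_sigma_finite (\<lambda>t. t powr s) Xi_G"
    using not_sf[OF c(1)] unfolding power .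
  moreover from this have "hausdorff_measure (\<lambda>t. t powr s) Xi_G = \<infinity>"
    by (rule infinite_measure_if_not_sigma_finite)
  moreover have "\<forall>\<theta><2. hausdorff_measure (\<lambda>t. t powr s * exp (- (\<bar>ln t\<bar> / (ln \<bar>ln t\<bar>) powr \<theta>))) Xi_G = 0"
    using hausdorff_measure_Xi_G_null unfolding s by blast
  ultimately show ?thesis by blast
qed

end
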